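(* Let $c_n$ be the number of words of length $2n$ over the standard generating set of Thompson's group $F$ that represent the identity of $F$, and let $\mu$ be the exponential growth rate of the sequence $(c_n)$, i.e. $\mu=\limsup_{n\to\infty}c_n^{1/n}$. Then $$\mu\ge 13.2693 .$$
   Context: Thompson's group $F$ is the group with presentation $$F=\langle x,y \mid x^{2}yx^{-2}=yxyx^{-1}y^{-1},\ x^{3}yx^{-3}=yx^{2}yx^{-2}y^{-1}\rangle ,$$ and its standard (inverse-closed) generating set is $\{x,y,x^{-1},y^{-1}\}$. *)

theory Defs
  imports "HOL-Algebra.Group" "HOL-Library.Extended_Real"
begin

section \<open>Groups given by generators and relations\<close>

datatype 'a letter = Gen 'a | Inv 'a

text \<open>
  A relation \<open>u = v\<close> is a pair \<open>(u, v)\<close> of words. \<open>pres_eq R\<close> is the least congruence on the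
  free monoid of words that contains \<open>R\<close> and makes \<open>Gen a\<close> and \<open>Inv a\<close> mutually inverse.
\<close>

inductive pres_eq :: "('a letter list \<times> 'a letter list) set \<Rightarrow> 'a letter list \<Rightarrow> 'a letter list \<Rightarrow> bool"
  for R where
  rel: "(u, v) \<in> R \<Longrightarrow> pres_eq R u v"
| cancel_right: "pres_eq R [Gen a, Inv a] []"
| cancel_left: "pres_eq R [Inv a, Gen a] []"
| refl: "pres_eq R u u"
| sym: "pres_eq R u v \<Longrightarrow> pres_eq R v u"
| trans: "pres_eq R u v \<Longrightarrow> pres_eq R v w \<Longrightarrow> pres_eq R u w"
| append: "pres_eq R u u' \<Longrightarrow> pres_eq R v v' \<Longrightarrow> pres_eq R (u @ v) (u' @ v')"

definition pres_class :: "('a letter list \<times> 'a letter list) set \<Rightarrow> 'a letter list \<Rightarrow> 'a letter list set"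
  where "pres_class R u = {v. pres_eq R u v}"

definition presented_group ::
  "('a letter list \<times> 'a letter list) set \<Rightarrow> 'a letter list set monoid"
  where "presented_group R =
    \<lparr>carrier = range (pres_class R),
     monoid.mult = (\<lambda>A B. \<Union>u\<in>A. \<Union>v\<in>B. pres_class R (u @ v)),
     one = pres_class R []\<rparr>"

fun letter_value :: "('g, 'm) monoid_scheme \<Rightarrow> ('a \<Rightarrow> 'g) \<Rightarrow> 'a letter \<Rightarrow> 'g" where
  "letter_value G f (Gen a) = f a"
| "letter_value G f (Inv a) = m_inv G (f a)"

definition word_value :: "('g, 'm) monoid_scheme \<Rightarrow> ('a \<Rightarrow> 'g) \<Rightarrow> 'a letter list \<Rightarrow> 'g" where
  "word_value G f w = foldr (\<lambda>l g. letter_value G f l \<otimes>\<^bsub>G\<^esub> g) w \<one>\<^bsub>G\<^esub>"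

lemma pres_class_eq_iff: "pres_class R u = pres_class R v \<longleftrightarrow> pres_eq R u v"
proof
  assume "pres_class R u = pres_class R v"
  moreover have "v \<in> pres_class R v" by (simp add: pres_class_def pres_eq.refl)
  ultimately have "v \<in> pres_class R u" by (simp only:)
  then show "pres_eq R u v" by (simp add: pres_class_def)
next
  assume uv: "pres_eq R u v"
  have "pres_eq R u w \<longleftrightarrow> pres_eq R v w" for w
    using pres_eq.trans[OF uv, of w] pres_eq.trans[OF pres_eq.sym[OF uv], of w] by blast
  then show "pres_class R u = pres_class R v" by (simp add: pres_class_def)
qed

lemma carrier_presented_group [simp]: "carrier (presented_group R) = range (pres_class R)"
  by (simp add: presented_group_def)

lemma one_presented_group [simp]: "\<one>\<^bsub>presented_group R\<^esub> = pres_class R []"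
  by (simp add: presented_group_def)

lemma mult_presented_group [simp]:
  "pres_class R u \<otimes>\<^bsub>presented_group R\<^esub> pres_class R v = pres_class R (u @ v)"
proof -
  have "pres_class R (u' @ v') = pres_class R (u @ v)"
    if "u' \<in> pres_class R u" "v' \<in> pres_class R v" for u' v'
    using that unfolding pres_class_eq_iff
    by (simp add: pres_class_def pres_eq.append pres_eq.sym)
  moreover have "u \<in> pres_class R u" "v \<in> pres_class R v"
    by (simp_all add: pres_class_def pres_eq.refl)
  ultimately have "(\<Union>u'\<in>pres_class R u. \<Union>v'\<in>pres_class R v. pres_class R (u' @ v')) = pres_class R (u @ v)"
    by blast
  then show ?thesis by (simp add: presented_group_def)
qed

lemma pres_class_left_inverse: "\<exists>v. pres_eq R (v @ u) []"
proof (induction u)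
  case Nil
  show ?case using pres_eq.refl[of R "[]"] by auto
next
  case (Cons l u)
  then obtain v where v: "pres_eq R (v @ u) []" by blast
  obtain l' where l': "pres_eq R [l', l] []"
    by (cases l) (blast intro: pres_eq.cancel_left pres_eq.cancel_right)+
  have "pres_eq R (v @ [l', l] @ u) (v @ [] @ u)"
    by (intro pres_eq.append pres_eq.refl l')
  then have "pres_eq R ((v @ [l']) @ l # u) []"
    using pres_eq.trans[OF _ v] by simp
  then show ?case by blast
qed

lemma group_presented_group: "group (presented_group R)"
proof (rule groupI)
  fix x assume "x \<in> carrier (presented_group R)"
  then obtain u where u: "x = pres_class R u" by auto
  obtain v where "pres_eq R (v @ u) []" using pres_class_left_inverse by blast
  then show "\<exists>y\<in>carrier (presented_group R). y \<otimes>\<^bsub>presented_group R\<^esub> x = \<one>\<^bsub>presented_group R\<^esub>"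
    by (auto simp: u pres_class_eq_iff)
qed auto

lemma inv_presented_group_gen:
  "m_inv (presented_group R) (pres_class R [Gen a]) = pres_class R [Inv a]"
  by (rule group.inv_equality[OF group_presented_group])
    (auto simp: pres_class_eq_iff pres_eq.cancel_left)

lemma word_value_presented_group:
  "word_value (presented_group R) (\<lambda>a. pres_class R [Gen a]) w = pres_class R w"
proof (induction w)
  case Nil
  show ?case by (simp add: word_value_def)
next
  case (Cons l w)
  then show ?case
    by (cases l) (simp_all add: word_value_def inv_presented_group_gen)
qed

section \<open>Thompson's group\<close>

datatype thompson_gen = X | Y

definition thompson_relations :: "(thompson_gen letter list \<times> thompson_gen letter list) set" where
  "thompson_relations =
    {([Gen X, Gen X, Gen Y, Inv X, Inv X],
      [Gen Y, Gen X, Gen Y, Inv X, Inv Y]),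
     ([Gen X, Gen X, Gen X, Gen Y, Inv X, Inv X, Inv X],
      [Gen Y, Gen X, Gen X, Gen Y, Inv X, Inv X, Inv Y])}"

definition thompson_F :: "thompson_gen letter list set monoid" where
  "thompson_F = presented_group thompson_relations"

definition thompson_value :: "thompson_gen letter list \<Rightarrow> thompson_gen letter list set" where
  "thompson_value = word_value thompson_F (\<lambda>a. pres_class thompson_relations [Gen a])"

definition cogrowth :: "nat \<Rightarrow> nat" where
  "cogrowth n = card {w :: thompson_gen letter list.
     length w = 2 * n \<and> thompson_value w = \<one>\<^bsub>thompson_F\<^esub>}"

lemma group_thompson_F: "group thompson_F"
  unfolding thompson_F_def by (rule group_presented_group)

lemma thompson_value_eq_one_iff:
  "thompson_value w = \<one>\<^bsub>thompson_F\<^esub> \<longleftrightarrow> pres_eq thompson_relations w []"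
  by (simp add: thompson_value_def thompson_F_def word_value_presented_group pres_class_eq_iff)

definition cogrowth_rate :: ereal where
  "cogrowth_rate = limsup (\<lambda>n. ereal (root n (real (cogrowth n))))"

end

(*
  Let A be the adjacency operator of a finite graph whose edges are labelled by x and y, each label
  acting as a partial injection. If f is a function on the vertices with <f, A f> >= lam <f, f>,
  then lam^(2k) is at most the number of closed walks of length 2k, and when every closed walk spells
  a trivial word of F this bounds the cogrowth from below by lam^2.

  The vertices are (not necessarily reduced) pairs of a top forest with a marked tree and a bottom
  tree with the same number n of leaves. The generator x moves the mark one tree to the right, and y
  joins the marked tree to its right neighbour, except that two single leaves lying over a caret of
  the bottom tree cancel with it. For f^2 take, for each n in a long window, the product measure in
  which the bottom tree is uniform and a top forest with m trees has weight 2^m. At n = infinity, with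
  f^2 of mass 1: the x-edges contribute 1; the y-edges into an unmatched non-leaf contribute
  sqrt 2 * (1/2 - 1/32), since a caret costs a factor 1/2 and half of the marked trees are leaves; the
  y-edges into a leaf contribute sqrt (1/8) / 2. Twice the sum is 3.679, and 3.643^2 > 13.2693.
*)
theory Submission
  imports Defs "HOL-Analysis.Convex" "HOL-Computational_Algebra.Formal_Power_Series"
begin

unbundle fps_syntax

section \<open>Thompson's group as an additive type\<close>

\<comment> \<open>The class \<open>group_add\<close> does not assume commutativity, so
  \<open>+\<close> can serve as the product of F. Cancellation and inverses then come from the type
  class rather than from a carrier set.\<close>
quotient_type thompson = "thompson_gen letter list" / "pres_eq thompson_relations"
proof (rule equivpI)
  show "reflp (pres_eq thompson_relations)"
    by (rule reflpI) (rule pres_eq.refl)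
  show "symp (pres_eq thompson_relations)"
    by (rule sympI) (rule pres_eq.sym)
  show "transp (pres_eq thompson_relations)"
    by (rule transpI) (rule pres_eq.trans)
qed

fun inv_letter :: "'a letter \<Rightarrow> 'a letter" where
  "inv_letter (Gen a) = Inv a"
| "inv_letter (Inv a) = Gen a"

definition inv_word :: "'a letter list \<Rightarrow> 'a letter list" where
  "inv_word w = rev (map inv_letter w)"

lemma inv_letter_inv_letter [simp]: "inv_letter (inv_letter l) = l"
  by (cases l) simp_all

lemma length_inv_word [simp]: "length (inv_word w) = length w"
  by (simp add: inv_word_def)

lemma inv_word_inv_word [simp]: "inv_word (inv_word w) = w"
  by (simp add: inv_word_def rev_map comp_def)

lemma inv_word_inject [simp]: "inv_word u = inv_word v \<longleftrightarrow> u = v"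
  by (metis inv_word_inv_word)

lemma pres_eq_append_inv_word: "pres_eq R (w @ inv_word w) []"
proof (induction w)
  case Nil
  show ?case by (simp add: inv_word_def pres_eq.refl)
next
  case (Cons l w)
  have "pres_eq R ([l] @ (w @ inv_word w) @ [inv_letter l]) ([l] @ [] @ [inv_letter l])"
    by (intro pres_eq.append pres_eq.refl Cons.IH)
  moreover have "pres_eq R [l, inv_letter l] []"
    by (cases l) (simp_all add: pres_eq.cancel_left pres_eq.cancel_right)
  ultimately show ?case
    by (auto simp: inv_word_def intro: pres_eq.trans)
qed

lemma pres_eq_inv_word_append: "pres_eq R (inv_word w @ w) []"
  using pres_eq_append_inv_word[of R "inv_word w"] by simp

text \<open>Inverses are unique: \<open>inv_word u @ v @ inv_word v\<close> reduces both to
  \<open>inv_word u\<close> and to \<open>inv_word v\<close>. This makes negation well defined on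
  classes.\<close>

lemma pres_eq_inv_word:
  assumes "pres_eq R u v"
  shows "pres_eq R (inv_word u) (inv_word v)"
proof -
  have 1: "pres_eq R (inv_word u @ v @ inv_word v) (inv_word u @ [])"
    by (intro pres_eq.append pres_eq.refl pres_eq_append_inv_word)
  have "pres_eq R (inv_word u @ v) (inv_word u @ u)"
    by (intro pres_eq.append pres_eq.refl pres_eq.sym[OF assms])
  then have "pres_eq R (inv_word u @ v) []"
    using pres_eq_inv_word_append pres_eq.trans by blast
  then have "pres_eq R ((inv_word u @ v) @ inv_word v) ([] @ inv_word v)"
    by (intro pres_eq.append pres_eq.refl)
  with 1 show ?thesis
    by (auto intro: pres_eq.trans pres_eq.sym)
qed

instantiation thompson :: group_add
begin

lift_definition zero_thompson :: thompson is "[]" .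

lift_definition plus_thompson :: "thompson \<Rightarrow> thompson \<Rightarrow> thompson" is "(@)"
  by (rule pres_eq.append)

lift_definition uminus_thompson :: "thompson \<Rightarrow> thompson" is inv_word
  by (rule pres_eq_inv_word)

definition minus_thompson :: "thompson \<Rightarrow> thompson \<Rightarrow> thompson" where
  "minus_thompson g h = g + - h"

instance
proof
  fix a b c :: thompson
  show "a + b + c = a + (b + c)"
    by transfer (simp add: pres_eq.refl)
  show "0 + a = a" "a + 0 = a"
    by (transfer, simp add: pres_eq.refl)+
  show "- a + a = 0"
    by transfer (rule pres_eq_inv_word_append)
  show "a + - b = a - b"
    by (simp add: minus_thompson_def)
qed

end

lift_definition of_word :: "thompson_gen letter list \<Rightarrow> thompson" is "\<lambda>w. w" .

lemma of_word_Nil: "of_word [] = 0"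
  by transfer (rule pres_eq.refl)

lemma of_word_append: "of_word (u @ v) = of_word u + of_word v"
  by transfer (rule pres_eq.refl)

lemma of_word_Cons: "of_word (l # w) = of_word [l] + of_word w"
  using of_word_append[of "[l]" w] by simp

lemma of_word_inv_word: "of_word (inv_word w) = - of_word w"
  by transfer (rule pres_eq.refl)

lemma of_word_Inv: "of_word [Inv a] = - of_word [Gen a]"
  using of_word_inv_word[of "[Gen a]"] by (simp add: inv_word_def)

lemma thompson_value_one_iff_of_word: "thompson_value w = \<one>\<^bsub>thompson_F\<^esub> \<longleftrightarrow> of_word w = 0"
  unfolding thompson_value_eq_one_iff by transfer simp

abbreviation xg :: thompson where "xg \<equiv> of_word [Gen X]"
abbreviation yg :: thompson where "yg \<equiv> of_word [Gen Y]"

section \<open>Conjugates of y by powers of x, and the infinite presentation\<close>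

definition shift :: "thompson \<Rightarrow> thompson" where
  "shift g = xg + g - xg"

lemma shift_add: "shift (g + h) = shift g + shift h"
  by (simp add: shift_def add.assoc diff_conv_add_uminus del: add_uminus_conv_diff)

lemma shift_0 [simp]: "shift 0 = 0"
  by (simp add: shift_def)

lemma funpow_shift_add: "(shift ^^ k) (g + h) = (shift ^^ k) g + (shift ^^ k) h"
  by (induction k) (simp_all add: shift_add)

lemma funpow_shift_0 [simp]: "(shift ^^ k) 0 = 0"
  by (induction k) simp_all

abbreviation ysh :: "nat \<Rightarrow> thompson" where
  "ysh n \<equiv> (shift ^^ n) yg"

lemma of_word_rel:
  assumes "(u, v) \<in> thompson_relations"
  shows "of_word u = of_word v"
  using assms by transfer (rule pres_eq.rel)

lemma ysh_2: "shift (shift yg) + yg = yg + shift yg"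
proof -
  have "of_word [Gen X, Gen X, Gen Y, Inv X, Inv X] = of_word [Gen Y, Gen X, Gen Y, Inv X, Inv Y]"
    by (rule of_word_rel) (simp add: thompson_relations_def)
  then have "shift (shift yg) = yg + shift yg + - yg"
    by (simp add: of_word_Cons[of _ "_ # _"] of_word_Inv shift_def add.assoc diff_conv_add_uminus
        del: add_uminus_conv_diff)
  then show ?thesis
    by (simp add: add.assoc)
qed

lemma ysh_3: "shift (shift (shift yg)) + yg = yg + shift (shift yg)"
proof -
  have "of_word [Gen X, Gen X, Gen X, Gen Y, Inv X, Inv X, Inv X] =
      of_word [Gen Y, Gen X, Gen X, Gen Y, Inv X, Inv X, Inv Y]"
    by (rule of_word_rel) (simp add: thompson_relations_def)
  then have "shift (shift (shift yg)) = yg + shift (shift yg) + - yg"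
    by (simp add: of_word_Cons[of _ "_ # _"] of_word_Inv shift_def add.assoc diff_conv_add_uminus
        del: add_uminus_conv_diff)
  then show ?thesis
    by (simp add: add.assoc)
qed

text \<open>The defining relations are the cases 0 and 1; the others follow from them. Write y_i for
  \<open>ysh i\<close>, multiplicatively. For n = m + 2 the product y y_(m+3) y_1 is carried by
  earlier relations and their conjugates to y_2 y_(m+3) y, then to y_(m+4) y y_1, and y_1 is
  cancelled.\<close>

lemma ysh_comm: "ysh (Suc (Suc n)) + yg = yg + ysh (Suc n)"
proof (induction n rule: less_induct)
  case (less n)
  consider "n = 0" | "n = 1" | m where "n = Suc (Suc m)"
    by (metis One_nat_def not0_implies_Suc)
  then show ?case
  proof cases
    case 3
    define p where "p = ysh (Suc m)"
    have h0: "shift p + yg = yg + p" and h1: "shift (shift p) + yg = yg + shift p"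
      using less.IH[of m] less.IH[of "Suc m"] 3 by (simp_all add: p_def)
    have h0': "shift (shift p) + shift yg = shift yg + shift p"
      using arg_cong[OF h0, of shift] by (simp add: shift_add)
    have h0'': "shift (shift (shift p)) + shift (shift yg) = shift (shift yg) + shift (shift p)"
      using arg_cong[OF h0', of shift] by (simp add: shift_add)
    have "(yg + shift (shift p)) + shift yg = (yg + shift yg) + shift p"
      by (simp only: add.assoc h0')
    also have "\<dots> = shift (shift yg) + (shift (shift p) + yg)"
      by (simp only: ysh_2[symmetric] h1 add.assoc)
    also have "\<dots> = (shift (shift (shift p)) + shift (shift yg)) + yg"
      by (simp only: h0'' add.assoc)
    also have "\<dots> = (shift (shift (shift p)) + yg) + shift yg"
      by (simp only: add.assoc ysh_2)
    finally show ?thesis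
      using 3 by (simp add: p_def)
  qed (use ysh_2 ysh_3 in simp_all)
qed

section \<open>Forest diagrams\<close>

datatype tree = Leaf | Node tree tree

primrec leaves :: "tree \<Rightarrow> nat" where
  "leaves Leaf = 1"
| "leaves (Node l r) = leaves l + leaves r"

lemma leaves_pos [simp]: "0 < leaves t"
  by (induction t) simp_all

lemma leaves_ge_1 [simp]: "Suc 0 \<le> leaves t"
  by (induction t) simp_all

text \<open>The leaf case ignores the index, so an index past the end splits the rightmost leaf.
  This keeps \<open>split_leaf j\<close> injective for every \<open>j\<close>.\<close>

fun split_leaf :: "nat \<Rightarrow> tree \<Rightarrow> tree" where
  "split_leaf j Leaf = Node Leaf Leaf"
| "split_leaf j (Node l r) =
    (if j < leaves l then Node (split_leaf j l) r else Node l (split_leaf (j - leaves l) r))"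

lemma leaves_split_leaf [simp]: "leaves (split_leaf j t) = Suc (leaves t)"
  by (induction j t rule: split_leaf.induct) simp_all

lemma split_leaf_inject:
  assumes "split_leaf j s = split_leaf j t"
  shows "s = t"
  using assms
proof (induction j s arbitrary: t rule: split_leaf.induct)
  case (1 j)
  show ?case
  proof (cases t)
    case (Node l r)
    have "leaves (split_leaf j t) = Suc (Suc 0)"
      using 1 by (metis One_nat_def Suc_eq_plus1 leaves.simps leaves_split_leaf)
    moreover have "Suc (Suc 0) \<le> leaves t"
      using leaves_ge_1[of l] leaves_ge_1[of r] unfolding Node leaves.simps by linarith
    ultimately show ?thesis by simp
  qed simp
next
  case (2 j l r)
  show ?case
  proof (cases t)
    case Leaf
    have "leaves (split_leaf j t) = Suc (Suc 0)"
      unfolding Leaf by simp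
    then have "leaves (Node l r) = Suc 0"
      using 2 by (metis Suc_inject leaves_split_leaf)
    moreover have "Suc (Suc 0) \<le> leaves (Node l r)"
      using leaves_ge_1[of l] leaves_ge_1[of r] unfolding leaves.simps by linarith
    ultimately show ?thesis by simp
  next
    case (Node l' r')
    show ?thesis
    proof (cases "j < leaves l")
      case True
      \<comment> \<open>Otherwise \<open>l'\<close> would equal \<open>split_leaf j l\<close>, so
        \<open>leaves l' = leaves l + 1\<close> would exceed \<open>j\<close> after all.\<close>
      then have "j < leaves l'"
        using 2(3) Node by (auto split: if_splits)
      then show ?thesis using True 2 Node by auto
    next
      case False
      then have "\<not> j < leaves l'"
        using 2(3) Node by (auto split: if_splits)
      then show ?thesis using False 2 Node by auto
    qed
  qed
qed

text \<open>Carets are multiplied from the leaves upwards. Once the left subtree is joined into a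
  single tree, the right one starts at position 1, hence the \<open>shift\<close>; the root then
  joins positions 0 and 1.\<close>

primrec tree_val :: "tree \<Rightarrow> thompson" where
  "tree_val Leaf = 0"
| "tree_val (Node l r) = tree_val l + shift (tree_val r) + yg"

primrec left_val :: "tree list \<Rightarrow> thompson" where
  "left_val [] = 0"
| "left_val (t # L) = left_val L + tree_val t + xg"

primrec right_val :: "tree list \<Rightarrow> thompson" where
  "right_val [] = 0"
| "right_val (t # R) = shift (tree_val t + right_val R)"

abbreviation forest_leaves :: "tree list \<Rightarrow> nat" where
  "forest_leaves L \<equiv> sum_list (map leaves L)"

text \<open>Disjoint carets commute up to renumbering: position \<open>Suc m\<close> after
  \<open>t\<close> has become one tree is position \<open>m + leaves t\<close> among its leaves and
  what follows them.\<close>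

lemma tree_val_ysh: "tree_val t + ysh (Suc m) = ysh (m + leaves t) + tree_val t"
proof (induction t arbitrary: m)
  case (Node l r)
  have "tree_val (Node l r) + ysh (Suc m) = tree_val l + shift (tree_val r + ysh (Suc m)) + yg"
    using ysh_comm[of m] by (simp add: shift_add add.assoc)
  also have "\<dots> = (tree_val l + ysh (Suc (m + leaves r))) + shift (tree_val r) + yg"
    by (simp only: Node.IH(2)) (simp add: shift_add add.assoc)
  also have "\<dots> = ysh (m + leaves (Node l r)) + tree_val (Node l r)"
    unfolding Node.IH(1)[of "m + leaves r"] by (simp add: add.assoc add.commute[of "leaves r"])
  finally show ?case .
qed simp

lemma left_val_ysh: "left_val L + ysh m = ysh (m + forest_leaves L) + left_val L"
proof (induction L arbitrary: m)
  case (Cons t L)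
  have "left_val (t # L) + ysh m = left_val L + (tree_val t + ysh (Suc m)) + xg"
    by (simp add: add.assoc shift_def)
  also have "\<dots> = (left_val L + ysh (m + leaves t)) + tree_val t + xg"
    by (simp only: tree_val_ysh add.assoc)
  also have "\<dots> = ysh (m + forest_leaves (t # L)) + left_val (t # L)"
    by (simp only: Cons.IH) (simp add: add.assoc)
  finally show ?case .
qed simp

text \<open>A caret added at a leaf is the first to be performed, so it is a left factor. If it lies
  in the right subtree, \<open>tree_val_ysh\<close> moves it past \<open>tree_val l\<close>.\<close>

lemma tree_val_split_leaf:
  assumes "j < leaves t"
  shows "tree_val (split_leaf j t) = ysh j + tree_val t"
  using assms
proof (induction j t rule: split_leaf.induct)
  case (2 j l r)
  show ?case
  proof (cases "j < leaves l")
    case True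
    then show ?thesis using 2 by (simp add: add.assoc)
  next
    case False
    define i where "i = j - leaves l"
    have j: "j = i + leaves l" and i: "i < leaves r"
      using False 2(3) by (auto simp: i_def)
    have "tree_val (split_leaf j (Node l r)) = (tree_val l + ysh (Suc i)) + shift (tree_val r) + yg"
      using False 2(2) i by (simp add: j shift_add add.assoc)
    also have "\<dots> = ysh j + tree_val (Node l r)"
      by (simp only: tree_val_ysh j) (simp add: add.assoc)
    finally show ?thesis .
  qed
qed simp

text \<open>\<open>g\<close> satisfies \<open>shift g + yg = yg + g\<close> iff it commutes with \<open>- xg + yg\<close>.\<close>

lemma shift_tree_val_comm:
  "(shift ^^ Suc (Suc k)) (tree_val t) + yg = yg + (shift ^^ Suc k) (tree_val t)"
proof (induction t arbitrary: k)
  case (Node l r)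
  have *: "shift (tree_val r) = (shift ^^ 1) (tree_val r)" by simp
  have "(shift ^^ Suc (Suc k)) (tree_val (Node l r)) + yg =
      (shift ^^ Suc (Suc k)) (tree_val l) + ((shift ^^ Suc (Suc (Suc k))) (tree_val r) + (ysh (Suc (Suc k)) + yg))"
    by (simp add: funpow_shift_add add.assoc shift_add funpow_swap1)
  also have "\<dots> = yg + ((shift ^^ Suc k) (tree_val l) + ((shift ^^ Suc (Suc k)) (tree_val r) + ysh (Suc k)))"
    by (simp only: ysh_comm) (simp only: add.assoc[symmetric] Node.IH)
  also have "\<dots> = yg + (shift ^^ Suc k) (tree_val (Node l r))"
    by (simp add: funpow_shift_add add.assoc shift_add funpow_swap1)
  finally show ?case .
qed simp

text \<open>A join at the mark lowers the numbers of all trees further right by one. The case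
  \<open>k = 0\<close> is what merging and cancelling use.\<close>

lemma shift_right_val_comm:
  "(shift ^^ Suc k) (right_val R) + yg = yg + (shift ^^ k) (right_val R)"
proof (induction R arbitrary: k)
  case (Cons t R)
  have "(shift ^^ Suc k) (right_val (t # R)) + yg =
      (shift ^^ Suc (Suc k)) (tree_val t) + ((shift ^^ Suc (Suc k)) (right_val R) + yg)"
    by (simp add: funpow_shift_add add.assoc shift_add funpow_swap1)
  also have "\<dots> = yg + ((shift ^^ Suc k) (tree_val t) + (shift ^^ Suc k) (right_val R))"
    by (simp only: Cons.IH) (simp only: add.assoc[symmetric] shift_tree_val_comm)
  also have "\<dots> = yg + (shift ^^ k) (right_val (t # R))"
    by (simp add: funpow_shift_add add.assoc shift_add funpow_swap1)
  finally show ?case .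
qed simp

text \<open>A state \<open>((L, t, R), b)\<close> has the marked tree \<open>t\<close>, the trees \<open>R\<close> to its right, and the trees \<open>L\<close> to its
  left listed from right to left. A caret joining the trees number \<open>k\<close> and \<open>k + 1\<close> stands for \<open>ysh k\<close>.\<close>

type_synonym state = "(tree list \<times> tree \<times> tree list) \<times> tree"

fun state_val :: "state \<Rightarrow> thompson" where
  "state_val ((L, t, R), b) = - tree_val b + left_val L + tree_val t + right_val R"

lemma state_val_move:
  "state_val ((t # L, r, R), b) = state_val ((L, t, r # R), b) + xg"
  by (simp add: shift_def add.assoc)

lemma state_val_merge:
  "state_val ((L, Node l r, R), b) = state_val ((L, l, r # R), b) + yg"
  using shift_right_val_comm[of 0 R] by (simp add: shift_add add.assoc)

text \<open>The new bottom caret contributes the inverse of \<open>ysh (forest_leaves L)\<close>. By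
  \<open>left_val_ysh\<close> this factor, moved past \<open>left_val L\<close>, is the inverse of
  the \<open>yg\<close> that joins the two leaves.\<close>

lemma state_val_cancel:
  assumes "forest_leaves L < leaves b"
  shows "state_val ((L, Leaf, R), b) =
    state_val ((L, Leaf, Leaf # R), split_leaf (forest_leaves L) b) + yg"
proof -
  have "left_val L + (shift (right_val R) + yg) = (left_val L + ysh 0) + right_val R"
    using shift_right_val_comm[of 0 R] by (simp add: add.assoc)
  also have "\<dots> = ysh (forest_leaves L) + (left_val L + right_val R)"
    by (simp only: left_val_ysh) (simp add: add.assoc)
  finally show ?thesis
    using assms by (simp add: tree_val_split_leaf minus_add add.assoc
        del: add_uminus_conv_diff)
qed

section \<open>Counting closed walks from a Rayleigh quotient\<close>

definition mat_app :: "'v set \<Rightarrow> ('v \<Rightarrow> 'v \<Rightarrow> real) \<Rightarrow> ('v \<Rightarrow> real) \<Rightarrow> 'v \<Rightarrow> real" where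
  "mat_app V a f u = (\<Sum>v\<in>V. a u v * f v)"

lemma sum_mult_mat_app:
  assumes sym: "\<And>u v. u \<in> V \<Longrightarrow> v \<in> V \<Longrightarrow> a u v = a v u"
  shows "(\<Sum>u\<in>V. f u * mat_app V a g u) = (\<Sum>u\<in>V. mat_app V a f u * g u)"
proof -
  have "(\<Sum>u\<in>V. f u * mat_app V a g u) = (\<Sum>u\<in>V. \<Sum>v\<in>V. f u * a u v * g v)"
    by (simp add: mat_app_def sum_distrib_left mult.assoc)
  also have "\<dots> = (\<Sum>v\<in>V. \<Sum>u\<in>V. f u * a u v * g v)"
    by (rule sum.swap)
  also have "\<dots> = (\<Sum>v\<in>V. mat_app V a f v * g v)"
    unfolding mat_app_def sum_distrib_right
    by (intro sum.cong HOL.refl) (simp add: sym)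
  finally show ?thesis .
qed

text \<open>The sequence of squared norms of the iterates is log-convex.\<close>

lemma norm_iterate_ge:
  fixes V :: "'v set" and a :: "'v \<Rightarrow> 'v \<Rightarrow> real" and f :: "'v \<Rightarrow> real"
  assumes sym: "\<And>u v. u \<in> V \<Longrightarrow> v \<in> V \<Longrightarrow> a u v = a v u"
    and lam: "0 < lam"
    and pos: "0 < (\<Sum>u\<in>V. (f u)\<^sup>2)"
    and ray: "lam * (\<Sum>u\<in>V. (f u)\<^sup>2) \<le> (\<Sum>u\<in>V. f u * mat_app V a f u)"
  shows "lam ^ (2 * k) * (\<Sum>u\<in>V. (f u)\<^sup>2) \<le> (\<Sum>u\<in>V. ((mat_app V a ^^ k) f u)\<^sup>2)"
proof -
  define s where "s k = (\<Sum>u\<in>V. ((mat_app V a ^^ k) f u)\<^sup>2)" for k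
  have s0: "s 0 = (\<Sum>u\<in>V. (f u)\<^sup>2)"
    by (simp add: s_def)
  have "(lam * s 0)\<^sup>2 \<le> (\<Sum>u\<in>V. f u * mat_app V a f u)\<^sup>2"
    using ray lam pos by (intro power_mono) (auto simp: s0)
  also have "\<dots> \<le> s 0 * s 1"
    using Cauchy_Schwarz_ineq_sum[of f "mat_app V a f" V] by (simp add: s_def)
  finally have "s 0 * (lam\<^sup>2 * s 0) \<le> s 0 * s 1"
    by (simp add: power2_eq_square ac_simps)
  then have s1: "lam\<^sup>2 * s 0 \<le> s 1"
    using pos by (simp add: s0)
  have log_convex: "(s (Suc k))\<^sup>2 \<le> s k * s (Suc (Suc k))" for k
  proof -
    have "s (Suc k) = (\<Sum>u\<in>V. (mat_app V a ^^ k) f u * (mat_app V a ^^ Suc (Suc k)) f u)"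
      using sum_mult_mat_app[of V a "(mat_app V a ^^ k) f" "(mat_app V a ^^ Suc k) f", OF sym]
      by (simp add: s_def power2_eq_square)
    then show ?thesis
      using Cauchy_Schwarz_ineq_sum[of "(mat_app V a ^^ k) f" "(mat_app V a ^^ Suc (Suc k)) f" V]
      by (simp add: s_def)
  qed
  have "0 < s k \<and> lam\<^sup>2 * s k \<le> s (Suc k)" for k
  proof (induction k)
    case 0
    then show ?case using s1 pos s0 by simp
  next
    case (Suc k)
    then have "0 < s (Suc k)"
      using lam by (metis less_le_trans mult_pos_pos zero_less_power)
    moreover have "s k * (lam\<^sup>2 * s (Suc k)) \<le> s k * s (Suc (Suc k))"
    proof -
      have "s k * (lam\<^sup>2 * s (Suc k)) = (lam\<^sup>2 * s k) * s (Suc k)" by simp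
      also have "\<dots> \<le> s (Suc k) * s (Suc k)"
        using Suc \<open>0 < s (Suc k)\<close> by (intro mult_right_mono) auto
      also have "\<dots> \<le> s k * s (Suc (Suc k))"
        using log_convex[of k] by (simp add: power2_eq_square)
      finally show ?thesis .
    qed
    ultimately show ?case using Suc by simp
  qed
  then have step: "lam\<^sup>2 * s k \<le> s (Suc k)" for k by blast
  have "lam ^ (2 * k) * s 0 \<le> s k"
  proof (induction k)
    case (Suc k)
    have "lam ^ (2 * Suc k) * s 0 = lam\<^sup>2 * (lam ^ (2 * k) * s 0)"
      by (simp add: power2_eq_square)
    also have "\<dots> \<le> lam\<^sup>2 * s k"
      using Suc by (intro mult_left_mono) auto
    also note step
    finally show ?case .
  qed simp
  then show ?thesis by (simp add: s_def)
qed

text \<open>A vertex has at most one outgoing and one incoming edge in each \<open>E a\<close>, so that a word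
  determines a partial injection of the vertices.\<close>

fun step :: "('a \<Rightarrow> ('v \<times> 'v) set) \<Rightarrow> 'a letter \<Rightarrow> 'v \<Rightarrow> 'v \<Rightarrow> bool" where
  "step E (Gen a) u v \<longleftrightarrow> (u, v) \<in> E a"
| "step E (Inv a) u v \<longleftrightarrow> (v, u) \<in> E a"

primrec walk :: "('a \<Rightarrow> ('v \<times> 'v) set) \<Rightarrow> 'a letter list \<Rightarrow> 'v \<Rightarrow> 'v \<Rightarrow> bool" where
  "walk E [] u v \<longleftrightarrow> u = v"
| "walk E (l # w) u v \<longleftrightarrow> (\<exists>u'. step E l u u' \<and> walk E w u' v)"

definition walks :: "('a \<Rightarrow> ('v \<times> 'v) set) \<Rightarrow> nat \<Rightarrow> 'v \<Rightarrow> 'v \<Rightarrow> 'a letter list set" where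
  "walks E k u v = {w. length w = k \<and> walk E w u v}"

lemma step_inv_letter: "step E (inv_letter l) v u \<longleftrightarrow> step E l u v"
  by (cases l) simp_all

lemma walk_append: "walk E (w @ w') u v \<longleftrightarrow> (\<exists>m. walk E w u m \<and> walk E w' m v)"
  by (induction w arbitrary: u) auto

lemma walk_inv_word: "walk E (inv_word w) v u \<longleftrightarrow> walk E w u v"
  by (induction w arbitrary: u) (auto simp: inv_word_def walk_append step_inv_letter)

section \<open>Adjacency matrix and closed walks of a labelled graph\<close>

locale labelled_graph =
  fixes V :: "'v set" and E :: "'a \<Rightarrow> ('v \<times> 'v) set"
  assumes finite_labels: "finite (UNIV :: 'a set)"
    and finite_V: "finite V"
    and E_V: "E a \<subseteq> V \<times> V"
    and E_out: "(u, v) \<in> E a \<Longrightarrow> (u, v') \<in> E a \<Longrightarrow> v = v'"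
    and E_in: "(u, v) \<in> E a \<Longrightarrow> (u', v) \<in> E a \<Longrightarrow> u = u'"
begin

lemma letters_eq: "(UNIV :: 'a letter set) = range Gen \<union> range Inv"
  using letter.exhaust by (metis UNIV_eq_I UnI1 UnI2 rangeI)

lemma finite_letters: "finite (UNIV :: 'a letter set)"
  using finite_labels by (simp add: letters_eq)

lemma step_in_V: "step E l u v \<Longrightarrow> u \<in> V \<and> v \<in> V"
  using E_V by (cases l) auto

lemma step_unique: "step E l u v \<Longrightarrow> step E l u v' \<Longrightarrow> v = v'"
  using E_out E_in by (cases l) auto

lemma walk_unique: "walk E w u v \<Longrightarrow> walk E w u v' \<Longrightarrow> v = v'"
  by (induction w arbitrary: u) (auto dest: step_unique)

lemma finite_walks: "finite (walks E k u v)"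
  using finite_lists_length_eq[OF finite_letters, of k]
  by (rule rev_finite_subset) (auto simp: walks_def)

text \<open>Letters are counted with multiplicity; a loop counts twice, once in each
  direction.\<close>

definition adj :: "'v \<Rightarrow> 'v \<Rightarrow> real" where
  "adj u v = real (card {l. step E l u v})"

lemma adj_sym: "adj u v = adj v u"
proof -
  have "{l. step E l v u} = inv_letter ` {l. step E l u v}"
    by (auto simp: step_inv_letter image_iff) (metis inv_letter_inv_letter step_inv_letter)
  moreover have "inj inv_letter"
    by (metis injI inv_letter_inv_letter)
  ultimately show ?thesis
    unfolding adj_def by (metis card_image inj_on_subset subset_UNIV)
qed

lemma card_walks_Suc:
  "real (card (walks E (Suc k) u v)) = (\<Sum>u'\<in>V. adj u u' * real (card (walks E k u' v)))"
proof -
  define S where "S u' = (\<lambda>(l, w). l # w) ` ({l. step E l u u'} \<times> walks E k u' v)" for u'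
  have "walks E (Suc k) u v = (\<Union>u'\<in>V. S u')"
    using step_in_V by (fastforce simp: walks_def S_def length_Suc_conv)
  moreover have "card (\<Union>u'\<in>V. S u') = (\<Sum>u'\<in>V. card (S u'))"
  proof (rule card_UN_disjoint[OF finite_V])
    show "\<forall>u'\<in>V. finite (S u')"
      using finite_subset[OF subset_UNIV finite_letters] by (simp add: S_def finite_walks)
    show "\<forall>i\<in>V. \<forall>j\<in>V. i \<noteq> j \<longrightarrow> S i \<inter> S j = {}"
      using step_unique by (auto simp: S_def)
  qed
  moreover have "card (S u') = card {l. step E l u u'} * card (walks E k u' v)" for u'
    unfolding S_def by (subst card_image) (auto simp: inj_on_def card_cartesian_product)
  ultimately show ?thesis
    by (simp add: adj_def)
qed

lemma mat_app_power_eq: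
  assumes "u \<in> V"
  shows "(mat_app V adj ^^ k) f u = (\<Sum>v\<in>V. real (card (walks E k u v)) * f v)"
  using assms
proof (induction k arbitrary: u)
  case 0
  have "walks E 0 u v = (if u = v then {[]} else {})" for v
    by (auto simp: walks_def)
  then have "real (card (walks E 0 u v)) * f v = (if u = v then f v else 0)" for v
    by simp
  then show ?case
    using 0 finite_V by simp
next
  case (Suc k)
  have "(mat_app V adj ^^ Suc k) f u =
      (\<Sum>u'\<in>V. adj u u' * (\<Sum>v\<in>V. real (card (walks E k u' v)) * f v))"
    by (simp add: mat_app_def Suc.IH)
  also have "\<dots> = (\<Sum>v\<in>V. \<Sum>u'\<in>V. adj u u' * real (card (walks E k u' v)) * f v)"
    unfolding sum_distrib_left by (subst sum.swap) (simp add: mult.assoc)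
  also have "\<dots> = (\<Sum>v\<in>V. real (card (walks E (Suc k) u v)) * f v)"
    by (simp add: card_walks_Suc sum_distrib_right)
  finally show ?case .
qed

text \<open>Two walks from \<open>u\<close> to \<open>v\<close> give a closed walk: out along the
  first, back along the second. Different \<open>v\<close> give different closed walks, because the
  first \<open>k\<close> letters determine the midpoint.\<close>

lemma sum_card_walks_squared:
  "(\<Sum>v\<in>V. (real (card (walks E k u v)))\<^sup>2) \<le> real (card (walks E (2 * k) u u))"
proof -
  define S where "S v = (\<lambda>(w, w'). w @ inv_word w') ` (walks E k u v \<times> walks E k u v)" for v
  have inj: "inj_on (\<lambda>(w, w'). w @ inv_word w') (walks E k u v \<times> walks E k u v)" for v
  proof (rule inj_onI, clarify)
    fix w1 w2 w1' w2'
    assume "w1 \<in> walks E k u v" "w1' \<in> walks E k u v" "w1 @ inv_word w2 = w1' @ inv_word w2'"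
    then show "w1 = w1' \<and> w2 = w2'" by (simp add: walks_def)
  qed
  have take: "take k w \<in> walks E k u v" and closed: "w \<in> walks E (2 * k) u u" if "w \<in> S v" for w v
  proof -
    obtain w1 w2 where w: "w = w1 @ inv_word w2" and w1: "length w1 = k" "walk E w1 u v"
      and w2: "length w2 = k" "walk E w2 u v"
      using \<open>w \<in> S v\<close> by (auto simp: S_def walks_def)
    show "take k w \<in> walks E k u v"
      using w1 by (simp add: w walks_def)
    have "walk E w u u"
      using w1(2) w2(2) unfolding w walk_append walk_inv_word by blast
    then show "w \<in> walks E (2 * k) u u"
      using w1(1) w2(1) by (simp add: w walks_def)
  qed
  have "S v \<inter> S v' = {}" if "v \<noteq> v'" for v v'
    using take walk_unique that unfolding walks_def by blast
  then have "(\<Sum>v\<in>V. card (S v)) = card (\<Union>v\<in>V. S v)"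
    by (intro card_UN_disjoint[symmetric] finite_V) (simp_all add: S_def finite_walks)
  also have "\<dots> \<le> card (walks E (2 * k) u u)"
    using closed by (intro card_mono finite_walks) blast
  finally have "(\<Sum>v\<in>V. card (S v)) \<le> card (walks E (2 * k) u u)" .
  moreover have "card (S v) = (card (walks E k u v))\<^sup>2" for v
    unfolding S_def card_image[OF inj] by (simp add: card_cartesian_product power2_eq_square)
  ultimately show ?thesis
    unfolding of_nat_power[symmetric] of_nat_sum[symmetric] of_nat_le_iff by simp
qed

lemma adj_eq: "adj u v = (\<Sum>a\<in>UNIV. of_bool ((u, v) \<in> E a) + of_bool ((v, u) \<in> E a))"
proof -
  have "{l. step E l u v} = Gen ` {a. (u, v) \<in> E a} \<union> Inv ` {a. (v, u) \<in> E a}"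
    by (auto simp: image_iff) (metis letter.exhaust step.simps)
  moreover have "card (Gen ` {a. (u, v) \<in> E a} \<union> Inv ` {a. (v, u) \<in> E a}) =
      card {a. (u, v) \<in> E a} + card {a. (v, u) \<in> E a}"
    using finite_subset[OF subset_UNIV finite_labels]
    by (subst card_Un_disjoint) (auto simp: card_image inj_on_def)
  ultimately show ?thesis
    using finite_labels by (simp add: adj_def sum.distrib sum.inter_filter[symmetric] of_bool_def)
qed

lemma rayleigh_eq:
  "(\<Sum>u\<in>V. f u * mat_app V adj f u) = 2 * (\<Sum>a\<in>UNIV. \<Sum>(u, v)\<in>E a. f u * f v)"
proof -
  have E_sum: "(\<Sum>u\<in>V. \<Sum>v\<in>V. of_bool ((u, v) \<in> E a) * (f u * f v)) = (\<Sum>(u, v)\<in>E a. f u * f v)" for a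
  proof -
    have "(\<Sum>u\<in>V. \<Sum>v\<in>V. of_bool ((u, v) \<in> E a) * (f u * f v)) =
        (\<Sum>p\<in>V \<times> V. if p \<in> E a then f (fst p) * f (snd p) else 0)"
      by (auto simp: sum.cartesian_product intro!: sum.cong)
    also have "\<dots> = (\<Sum>p\<in>E a. f (fst p) * f (snd p))"
      using finite_V E_V[of a] by (subst sum.inter_restrict[symmetric]) (auto simp: Int_absorb1)
    finally show ?thesis by (simp add: case_prod_beta)
  qed
  have E_sum': "(\<Sum>u\<in>V. \<Sum>v\<in>V. of_bool ((v, u) \<in> E a) * (f u * f v)) = (\<Sum>(u, v)\<in>E a. f u * f v)" for a
    by (subst sum.swap, subst E_sum[symmetric]) (simp add: mult.commute)
  have "(\<Sum>u\<in>V. f u * mat_app V adj f u) =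
      (\<Sum>u\<in>V. \<Sum>v\<in>V. \<Sum>a\<in>UNIV. of_bool ((u, v) \<in> E a) * (f u * f v) + of_bool ((v, u) \<in> E a) * (f u * f v))"
    by (simp add: mat_app_def adj_eq sum_distrib_left sum_distrib_right algebra_simps)
  also have "\<dots> = (\<Sum>u\<in>V. \<Sum>a\<in>UNIV. \<Sum>v\<in>V. of_bool ((u, v) \<in> E a) * (f u * f v) + of_bool ((v, u) \<in> E a) * (f u * f v))"
    by (intro sum.cong HOL.refl sum.swap)
  also have "\<dots> = (\<Sum>a\<in>UNIV. \<Sum>u\<in>V. \<Sum>v\<in>V. of_bool ((u, v) \<in> E a) * (f u * f v) + of_bool ((v, u) \<in> E a) * (f u * f v))"
    by (rule sum.swap)
  also have "\<dots> = (\<Sum>a\<in>UNIV. 2 * (\<Sum>(u, v)\<in>E a. f u * f v))"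
    by (simp only: sum.distrib E_sum E_sum' mult_2)
  finally show ?thesis by (simp add: sum_distrib_left)
qed

text \<open>The squared norm of the k-th iterate of \<open>f\<close> is bounded below by
  \<open>norm_iterate_ge\<close>. From above, Cauchy-Schwarz at each vertex bounds the squared value
  by the number of closed walks times the squared norm of \<open>f\<close>, which then
  cancels.\<close>

lemma sum_closed_walks_ge:
  assumes lam: "0 < lam"
    and pos: "0 < (\<Sum>u\<in>V. (f u)\<^sup>2)"
    and ray: "lam * (\<Sum>u\<in>V. (f u)\<^sup>2) \<le> 2 * (\<Sum>a\<in>UNIV. \<Sum>(u, v)\<in>E a. f u * f v)"
  shows "lam ^ (2 * k) \<le> (\<Sum>u\<in>V. real (card (walks E (2 * k) u u)))"
proof -
  let ?s = "\<Sum>u\<in>V. (f u)\<^sup>2"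
  have "lam ^ (2 * k) * ?s \<le> (\<Sum>u\<in>V. ((mat_app V adj ^^ k) f u)\<^sup>2)"
    by (rule norm_iterate_ge) (use assms adj_sym rayleigh_eq in auto)
  also have "\<dots> \<le> (\<Sum>u\<in>V. real (card (walks E (2 * k) u u)) * ?s)"
  proof (rule sum_mono)
    fix u assume u: "u \<in> V"
    have "((mat_app V adj ^^ k) f u)\<^sup>2 \<le> (\<Sum>v\<in>V. (real (card (walks E k u v)))\<^sup>2) * ?s"
      unfolding mat_app_power_eq[OF u] by (rule Cauchy_Schwarz_ineq_sum)
    also have "\<dots> \<le> real (card (walks E (2 * k) u u)) * ?s"
      using sum_card_walks_squared pos by (intro mult_right_mono) auto
    finally show "((mat_app V adj ^^ k) f u)\<^sup>2 \<le> real (card (walks E (2 * k) u u)) * ?s" .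
  qed
  also have "\<dots> = (\<Sum>u\<in>V. real (card (walks E (2 * k) u u))) * ?s"
    by (simp add: sum_distrib_right)
  finally show ?thesis using pos by simp
qed

end

section \<open>Weighted counting of forests\<close>

text \<open>A sum over an infinite set is 0, so this is the expected generating function only if
  each size occurs finitely often; the product rules assume this.\<close>

definition gf :: "('a \<Rightarrow> nat) \<Rightarrow> ('a \<Rightarrow> real) \<Rightarrow> real fps" where
  "gf sz wt = Abs_fps (\<lambda>n. \<Sum>a | sz a = n. wt a)"

lemma gf_nth: "gf sz wt $ n = (\<Sum>a | sz a = n. wt a)"
  by (simp add: gf_def)

lemma finite_pair_size:
  assumes "\<And>n. finite {a. sz a = n}" "\<And>n. finite {b. sz' b = n}"
  shows "finite {(a, b). sz a + sz' b = (n::nat)}"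
proof (rule finite_subset)
  show "{(a, b). sz a + sz' b = n} \<subseteq> (\<Union>i\<le>n. {a. sz a = i} \<times> {b. sz' b = n - i})"
    by auto
qed (use assms in simp)

lemma sum_pair_size:
  assumes "\<And>n. finite {a. sz a = n}" "\<And>n. finite {b. sz' b = n}"
  shows "(\<Sum>(a, b) | sz a + sz' b = n. wt a * wt' b) = (gf sz wt * gf sz' wt') $ n"
proof -
  let ?P = "{(a, b). sz a + sz' b = n}"
  have fin: "finite ?P"
    using finite_pair_size assms by blast
  have eq: "{p \<in> ?P. sz (fst p) = i} = {a. sz a = i} \<times> {b. sz' b = n - i}" if "i \<in> {0..n}" for i
    using that by auto
  have "(\<Sum>(a, b)\<in>?P. wt a * wt' b) = (\<Sum>i=0..n. \<Sum>(a, b)\<in>{p \<in> ?P. sz (fst p) = i}. wt a * wt' b)"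
    by (rule sum.group[symmetric]) (use fin in auto)
  also have "\<dots> = (\<Sum>i=0..n. (\<Sum>a | sz a = i. wt a) * (\<Sum>b | sz' b = n - i. wt' b))"
    by (intro sum.cong HOL.refl) (simp only: eq sum.cartesian_product[symmetric] sum_product)
  finally show ?thesis
    by (simp add: fps_mult_nth gf_nth)
qed

lemma gf_pair:
  assumes "\<And>n. finite {a. sz a = n}" "\<And>n. finite {b. sz' b = n}"
  shows "gf (\<lambda>(a, b). sz a + sz' b) (\<lambda>(a, b). wt a * wt' b) = gf sz wt * gf sz' wt'"
proof (rule fps_ext)
  fix n
  have "{p. (case p of (a, b) \<Rightarrow> sz a + sz' b) = n} = {(a, b). sz a + sz' b = n}"
    by auto
  then show "gf (\<lambda>(a, b). sz a + sz' b) (\<lambda>(a, b). wt a * wt' b) $ n = (gf sz wt * gf sz' wt') $ n"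
    by (simp only: gf_nth sum_pair_size[OF assms])
qed

lemma finite_leaves_eq: "finite {t. leaves t = n}"
proof (induction n rule: less_induct)
  case (less n)
  have "{t. leaves t = n} \<subseteq> insert Leaf (\<Union>i<n. \<Union>j<n. case_prod Node ` ({t. leaves t = i} \<times> {t. leaves t = j}))"
  proof
    fix t assume "t \<in> {t. leaves t = n}"
    then show "t \<in> insert Leaf (\<Union>i<n. \<Union>j<n. case_prod Node ` ({t. leaves t = i} \<times> {t. leaves t = j}))"
      using leaves_pos by (cases t) force+
  qed
  then show ?case
    by (rule finite_subset) (use less in auto)
qed

lemma finite_forest_leaves_eq: "finite {L. forest_leaves L = n}"
proof (induction n rule: less_induct)
  case (less n)
  have "{L. forest_leaves L = n} \<subseteq>
      insert [] (\<Union>i\<le>n. \<Union>j<n. case_prod (#) ` ({t. leaves t = i} \<times> {L. forest_leaves L = j}))"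
  proof
    fix L assume "L \<in> {L. forest_leaves L = n}"
    then show "L \<in> insert [] (\<Union>i\<le>n. \<Union>j<n. case_prod (#) ` ({t. leaves t = i} \<times> {L. forest_leaves L = j}))"
      using leaves_pos by (cases L) force+
  qed
  then show ?case
    by (rule finite_subset) (use less finite_leaves_eq in auto)
qed

section \<open>Generating functions of trees and weighted forests\<close>

abbreviation tree_gf :: "real fps" where
  "tree_gf \<equiv> gf leaves (\<lambda>_. 1)"

text \<open>Each tree of a forest has weight 2; this makes \<open>2 * tree_gf\<close> equal to 1 at the radius of
  convergence 1/4 of \<open>tree_gf\<close>.\<close>

abbreviation forest_gf :: "real fps" where
  "forest_gf \<equiv> gf forest_leaves (\<lambda>L. 2 ^ length L)"

lemma tree_gf_eq: "tree_gf = fps_X + tree_gf * tree_gf"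
proof (rule fps_ext)
  fix n
  let ?N = "{(l, r). leaves l + leaves r = n}"
  have "{t. leaves t = n} = (if n = 1 then {Leaf} else {}) \<union> case_prod Node ` ?N"
  proof (rule Set.set_eqI)
    fix t show "t \<in> {t. leaves t = n} \<longleftrightarrow> t \<in> (if n = 1 then {Leaf} else {}) \<union> case_prod Node ` ?N"
      by (cases t) auto
  qed
  moreover have "card \<dots> = card (if n = 1 then {Leaf} else {}) + card (case_prod Node ` ?N)"
    using finite_pair_size[OF finite_leaves_eq finite_leaves_eq] by (intro card_Un_disjoint) auto
  moreover have "card (case_prod Node ` ?N) = card ?N"
    by (rule card_image) (auto simp: inj_on_def)
  moreover have "real (card ?N) = (tree_gf * tree_gf) $ n"
    using sum_pair_size[OF finite_leaves_eq finite_leaves_eq, of "\<lambda>_. 1" "\<lambda>_. 1" n]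
    by simp
  ultimately show "tree_gf $ n = (fps_X + tree_gf * tree_gf) $ n"
    by (simp add: gf_nth fps_X_def)
qed

lemma gf_leaves_2: "gf leaves (\<lambda>_. 2) = 2 * tree_gf"
  by (rule fps_ext) (simp add: gf_nth fps_numeral_fps_const)

lemma forest_gf_eq: "forest_gf = 1 + 2 * tree_gf * forest_gf"
proof (rule fps_ext)
  fix n
  let ?N = "{(t, L). leaves t + forest_leaves L = n}"
  have "{L. forest_leaves L = n} = (if n = 0 then {[] :: tree list} else {}) \<union> case_prod (#) ` ?N"
  proof (rule Set.set_eqI)
    fix L show "L \<in> {L. forest_leaves L = n} \<longleftrightarrow> L \<in> (if n = 0 then {[] :: tree list} else {}) \<union> case_prod (#) ` ?N"
      by (cases L) auto
  qed
  then have "forest_gf $ n = (\<Sum>L\<in>(if n = 0 then {[] :: tree list} else {}) \<union> case_prod (#) ` ?N. 2 ^ length L)"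
    by (simp add: gf_nth)
  also have "\<dots> = (\<Sum>L\<in>(if n = 0 then {[] :: tree list} else {}). 2 ^ length L) + (\<Sum>L\<in>case_prod (#) ` ?N. 2 ^ length L)"
    by (rule sum.union_disjoint) (auto simp: finite_pair_size[OF finite_leaves_eq finite_forest_leaves_eq])
  also have "(\<Sum>L\<in>case_prod (#) ` ?N. 2 ^ length L) = (\<Sum>(t, L)\<in>?N. 2 * 2 ^ length L)"
    by (subst sum.reindex) (auto simp: inj_on_def case_prod_beta)
  also have "\<dots> = (gf leaves (\<lambda>_. 2) * forest_gf) $ n"
    by (rule sum_pair_size[OF finite_leaves_eq finite_forest_leaves_eq])
  also note gf_leaves_2
  finally show "forest_gf $ n = (1 + 2 * tree_gf * forest_gf) $ n"
    by simp
qed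

text \<open>Completing the square in the Catalan equation: formally, 1 - 2T is the square root of 1
  - 4X.\<close>

lemma one_minus_two_tree_gf_squared: "(1 - 2 * tree_gf)\<^sup>2 = 1 - 4 * fps_X"
proof -
  have "(1 - 2 * tree_gf)\<^sup>2 = 1 - 4 * (tree_gf - tree_gf * tree_gf)"
    by (simp add: power2_eq_square algebra_simps)
  also have "tree_gf - tree_gf * tree_gf = fps_X"
    using tree_gf_eq by (metis add_diff_cancel_right')
  finally show ?thesis .
qed

lemma forest_gf_mult_eq_1: "forest_gf * (1 - 2 * tree_gf) = 1"
  using forest_gf_eq by (simp add: algebra_simps)

text \<open>\<open>forest_gf\<close> is the inverse square root of 1 - 4X, with the central binomial
  coefficients, so its square is the geometric series of ratio 4.\<close>

lemma forest_gf_squared_nth: "(forest_gf * forest_gf) $ n = 4 ^ n"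
proof -
  have eq: "(forest_gf * forest_gf) * (1 - 4 * fps_X) = 1"
  proof -
    have "(forest_gf * forest_gf) * (1 - 4 * fps_X) = forest_gf\<^sup>2 * (1 - 2 * tree_gf)\<^sup>2"
      by (simp only: one_minus_two_tree_gf_squared power2_eq_square[of forest_gf])
    also have "\<dots> = (forest_gf * (1 - 2 * tree_gf))\<^sup>2"
      by (simp only: power_mult_distrib)
    finally show ?thesis by (simp only: forest_gf_mult_eq_1 one_power2)
  qed
  have nth: "((forest_gf * forest_gf) * (1 - 4 * fps_X)) $ n =
      (forest_gf * forest_gf) $ n - 4 * (if n = 0 then 0 else (forest_gf * forest_gf) $ (n - 1))" for n
  proof -
    have "(forest_gf * forest_gf) * (1 - 4 * fps_X) =
        forest_gf * forest_gf - fps_const 4 * (fps_X * (forest_gf * forest_gf))"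
      by (simp add: algebra_simps fps_numeral_fps_const)
    then show ?thesis by (simp only: fps_sub_nth fps_mult_left_const_nth fps_X_mult_nth)
  qed
  show ?thesis
  proof (induction n)
    case 0
    show ?case using nth[of 0] eq by simp
  next
    case (Suc n)
    then show ?case using nth[of "Suc n"] eq by simp
  qed
qed

lemma sum_two_forests:
  "(\<Sum>(L, R) | forest_leaves L + forest_leaves R = n. 2 ^ length L * 2 ^ length R) = (4 ^ n :: real)"
  using forest_gf_squared_nth[of n]
  by (simp add: sum_pair_size[OF finite_forest_leaves_eq finite_forest_leaves_eq])

text \<open>Splitting off the last tree of a nonempty forest preserves the weight;
  \<open>0 < n\<close> excludes the empty forest.\<close>

lemma sum_forest_tree:
  assumes "0 < n"
  shows "(\<Sum>(L, t) | forest_leaves L + leaves t = n. 2 ^ length L * 2) = forest_gf $ n"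
proof -
  have "(\<Sum>(L, t) | forest_leaves L + leaves t = n. 2 ^ length L * 2) =
      (forest_gf * gf leaves (\<lambda>_. 2)) $ n"
    by (rule sum_pair_size[OF finite_forest_leaves_eq finite_leaves_eq])
  also note gf_leaves_2
  also have "(forest_gf * (2 * tree_gf)) $ n = forest_gf $ n"
    using arg_cong[OF forest_gf_eq, of "\<lambda>g. g $ n"] assms by (simp add: ac_simps)
  finally show ?thesis .
qed

section \<open>Growth of the Catalan numbers\<close>

abbreviation ntrees :: "nat \<Rightarrow> real" where
  "ntrees n \<equiv> tree_gf $ n"

lemma ntrees_eq: "ntrees n = real (card {t. leaves t = n})"
  by (simp add: gf_nth)

text \<open>Differentiating T = X + T^2 gives (1 - 2T) T' = 1. Multiplying by 1 - 2T yields the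
  linear equation (1 - 4X) T' = 1 - 2T, whose n-th coefficient is the recurrence.\<close>

lemma ntrees_Suc:
  assumes "0 < n"
  shows "real (n + 1) * ntrees (n + 1) = (4 * real n - 2) * ntrees n"
proof -
  define D where "D = fps_deriv tree_gf"
  have "D = fps_deriv (fps_X + tree_gf * tree_gf)"
    unfolding D_def by (rule arg_cong[OF tree_gf_eq])
  then have "D = 1 + 2 * tree_gf * D"
    by (simp add: D_def mult.assoc)
  then have "(1 - 2 * tree_gf) * D = 1"
    by (simp add: algebra_simps)
  then have "(1 - 2 * tree_gf)\<^sup>2 * D = 1 - 2 * tree_gf"
    by (simp add: power2_eq_square mult.assoc)
  then have "(1 - 4 * fps_X) * D = 1 - 2 * tree_gf"
    by (simp only: one_minus_two_tree_gf_squared)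
  then have "D - fps_const 4 * (fps_X * D) = 1 - fps_const 2 * tree_gf"
    by (simp add: algebra_simps fps_numeral_fps_const)
  then have "(D - fps_const 4 * (fps_X * D)) $ n = (1 - fps_const 2 * tree_gf) $ n"
    by simp
  then show ?thesis
    using assms by (simp only: fps_sub_nth fps_mult_left_const_nth fps_X_mult_nth)
      (simp add: D_def algebra_simps)
qed

lemma ntrees_pos:
  assumes "0 < n"
  shows "0 < ntrees n"
  using assms
proof (induction n rule: nat_induct_non_zero)
  case 1
  have "{t. leaves t = 1} = {Leaf}"
  proof (rule Set.set_eqI)
    fix t show "t \<in> {t. leaves t = 1} \<longleftrightarrow> t \<in> {Leaf}"
      by (cases t) (auto simp: add_is_1)
  qed
  then show ?case by (simp add: ntrees_eq)
next
  case (Suc n)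
  then have "0 < real (n + 1) * ntrees (n + 1)"
    unfolding ntrees_Suc[OF Suc(1)] by (intro mult_pos_pos) auto
  then show ?case by (simp add: zero_less_mult_iff)
qed

lemma ntrees_Suc_le:
  assumes "0 < n"
  shows "ntrees (n + 1) \<le> 4 * ntrees n"
proof -
  have "real (n + 1) * ntrees (n + 1) \<le> real (n + 1) * (4 * ntrees n)"
    unfolding ntrees_Suc[OF assms] using ntrees_pos[OF assms] by (simp add: algebra_simps)
  then show ?thesis by simp
qed

text \<open>The central binomial coefficient divided by 4^n, of order 1 / sqrt n. It is both the
  mass of the states marked at their last tree (\<open>mass_last\<close>) and the amount by which a
  level falls short of mass 1 (\<open>mass_total\<close>).\<close>

definition last_mass :: "nat \<Rightarrow> real" where
  "last_mass n = forest_gf $ n / 4 ^ n"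

lemma last_mass_nonneg: "0 \<le> last_mass n"
  by (simp add: last_mass_def gf_nth sum_nonneg)

lemma sum_last_mass_convolution: "(\<Sum>i\<le>n. last_mass i * last_mass (n - i)) = 1"
proof -
  have "last_mass i * last_mass (n - i) = forest_gf $ i * forest_gf $ (n - i) / 4 ^ n" if "i \<le> n" for i
    using that by (simp add: last_mass_def power_add[symmetric])
  then have "(\<Sum>i\<le>n. last_mass i * last_mass (n - i)) = (forest_gf * forest_gf) $ n / 4 ^ n"
    by (simp add: fps_mult_nth sum_divide_distrib atLeast0AtMost)
  then show ?thesis by (simp add: forest_gf_squared_nth)
qed

text \<open>The square of pairs up to \<open>N\<close> lies in the triangle
  \<open>i + j \<le> 2 * N\<close>, each of whose antidiagonals sums to 1.\<close>

lemma sum_last_mass_squared_le: "(\<Sum>n\<le>N. last_mass n)\<^sup>2 \<le> real (2 * N + 1)"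
proof -
  have fin: "finite {(i, j). i + j \<le> 2 * N}"
    by (rule finite_subset[of _ "{..2 * N} \<times> {..2 * N}"]) auto
  have "(\<Sum>n\<le>N. last_mass n)\<^sup>2 = (\<Sum>(i, j)\<in>{..N} \<times> {..N}. last_mass i * last_mass j)"
    by (simp add: power2_eq_square sum_product sum.cartesian_product)
  also have "\<dots> \<le> (\<Sum>(i, j) | i + j \<le> 2 * N. last_mass i * last_mass j)"
    by (rule sum_mono2[OF fin]) (auto simp: last_mass_nonneg)
  also have "\<dots> = real (2 * N + 1)"
    by (simp add: sum.triangle_reindex_eq sum_last_mass_convolution)
  finally show ?thesis .
qed

section \<open>The test function\<close>

text \<open>The brackets follow the nesting of the triple, so that the product rule for pairs
  applies twice.\<close>

fun pointed_leaves :: "tree list \<times> tree \<times> tree list \<Rightarrow> nat" where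
  "pointed_leaves (L, t, R) = forest_leaves L + (leaves t + forest_leaves R)"

fun pointed_weight :: "tree list \<times> tree \<times> tree list \<Rightarrow> real" where
  "pointed_weight (L, t, R) = 2 ^ length L * (2 * 2 ^ length R)"

lemma pointed_weight_pos: "0 < pointed_weight p"
  by (cases p rule: pointed_weight.cases) simp

lemma finite_pointed: "finite {p. pointed_leaves p = n}"
proof -
  have "{p. pointed_leaves p = n} = {(L, q). forest_leaves L + (case q of (t, R) \<Rightarrow> leaves t + forest_leaves R) = n}"
    by auto
  moreover have "finite {q. (case q of (t, R) \<Rightarrow> leaves t + forest_leaves R) = n}" for n
    using finite_pair_size[OF finite_leaves_eq finite_forest_leaves_eq, of n] by (simp add: case_prod_beta')
  ultimately show ?thesis
    using finite_pair_size[OF finite_forest_leaves_eq] by metis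
qed

text \<open>With F for \<open>forest_gf\<close>, left forest, marked tree and right forest give F
  (2T) F = F (F - 1), and F^2 has coefficients 4^n.\<close>

lemma sum_pointed_weight: "(\<Sum>p | pointed_leaves p = n. pointed_weight p) = 4 ^ n - forest_gf $ n"
proof -
  have fin: "finite {q. (case q of (t, R) \<Rightarrow> leaves t + forest_leaves R) = n}" for n
    using finite_pair_size[OF finite_leaves_eq finite_forest_leaves_eq, of n] by (simp add: case_prod_beta')
  have "{p. pointed_leaves p = n} = {(L, q). forest_leaves L + (case q of (t, R) \<Rightarrow> leaves t + forest_leaves R) = n}"
    by auto
  then have "(\<Sum>p | pointed_leaves p = n. pointed_weight p) =
      (\<Sum>(L, q) | forest_leaves L + (case q of (t, R) \<Rightarrow> leaves t + forest_leaves R) = n.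
        2 ^ length L * (case q of (t, R) \<Rightarrow> 2 * 2 ^ length R))"
    by (intro sum.cong) auto
  also have "\<dots> = (forest_gf * (gf leaves (\<lambda>_. 2) * forest_gf)) $ n"
    by (simp only: sum_pair_size[OF finite_forest_leaves_eq fin] gf_pair[OF finite_leaves_eq finite_forest_leaves_eq])
  also have "gf leaves (\<lambda>_. 2) * forest_gf = forest_gf - 1"
    using forest_gf_eq by (simp add: gf_leaves_2 algebra_simps)
  also have "(forest_gf * (forest_gf - 1)) $ n = 4 ^ n - forest_gf $ n"
    by (simp only: right_diff_distrib fps_sub_nth forest_gf_squared_nth mult_1_right)
  finally show ?thesis .
qed

lemma sum_pointed_weight_last:
  assumes "0 < n"
  shows "(\<Sum>p | pointed_leaves p = n \<and> snd (snd p) = []. pointed_weight p) = forest_gf $ n"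
proof -
  have "{p. pointed_leaves p = n \<and> snd (snd p) = []} =
      (\<lambda>(L, t). (L, t, [])) ` {(L, t). forest_leaves L + leaves t = n}"
    by (auto simp: image_iff)
  then have "(\<Sum>p | pointed_leaves p = n \<and> snd (snd p) = []. pointed_weight p) =
      (\<Sum>(L, t) | forest_leaves L + leaves t = n. 2 ^ length L * 2)"
    by (simp add: sum.reindex inj_on_def case_prod_beta')
  then show ?thesis by (simp only: sum_forest_tree[OF assms])
qed

text \<open>Once the marked tree is fixed, two arbitrary forests remain, so the count is
  exact.\<close>

lemma sum_pointed_weight_tree:
  "(\<Sum>p | pointed_leaves p = n + leaves t \<and> fst (snd p) = t. pointed_weight p) = 2 * 4 ^ n"
proof -
  have "{p. pointed_leaves p = n + leaves t \<and> fst (snd p) = t} =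
      (\<lambda>(L, R). (L, t, R)) ` {(L, R). forest_leaves L + forest_leaves R = n}"
    by (auto simp: image_iff)
  then have "(\<Sum>p | pointed_leaves p = n + leaves t \<and> fst (snd p) = t. pointed_weight p) =
      (\<Sum>(L, R) | forest_leaves L + forest_leaves R = n. 2 * (2 ^ length L * 2 ^ length R))"
    by (simp add: sum.reindex inj_on_def case_prod_beta' mult.left_commute)
  also have "\<dots> = 2 * (\<Sum>(L, R) | forest_leaves L + forest_leaves R = n. 2 ^ length L * 2 ^ length R)"
    by (simp add: sum_distrib_left case_prod_beta')
  finally show ?thesis by (simp only: sum_two_forests)
qed

section \<open>The measure on each level and the masses of the relevant sets\<close>

definition level :: "nat \<Rightarrow> state set" where
  "level n = {p. pointed_leaves p = n} \<times> {b. leaves b = n}"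

definition weight :: "state \<Rightarrow> real" where
  "weight s = pointed_weight (fst s) / (ntrees (leaves (snd s)) * 4 ^ leaves (snd s))"

definition mass :: "nat \<Rightarrow> (state \<Rightarrow> bool) \<Rightarrow> real" where
  "mass n Q = (\<Sum>s | s \<in> level n \<and> Q s. weight s)"

lemma finite_level: "finite (level n)"
  by (simp add: level_def finite_pointed finite_leaves_eq)

lemma weight_pos: "0 < weight s"
  by (simp add: weight_def pointed_weight_pos ntrees_pos)

lemma mass_fst:
  assumes "0 < n"
  shows "mass n (\<lambda>s. Q (fst s)) = (\<Sum>p | pointed_leaves p = n \<and> Q p. pointed_weight p) / 4 ^ n"
proof -
  have "{s. s \<in> level n \<and> Q (fst s)} = {p. pointed_leaves p = n \<and> Q p} \<times> {b. leaves b = n}"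
    by (auto simp: level_def)
  then have "mass n (\<lambda>s. Q (fst s)) =
      (\<Sum>p | pointed_leaves p = n \<and> Q p. \<Sum>b | leaves b = n. weight (p, b))"
    by (simp add: mass_def sum.cartesian_product)
  also have "\<dots> = (\<Sum>p | pointed_leaves p = n \<and> Q p. pointed_weight p / 4 ^ n)"
  proof (intro sum.cong HOL.refl)
    fix p
    have "(\<Sum>b | leaves b = n. weight (p, b)) = (\<Sum>b | leaves b = n. pointed_weight p / (ntrees n * 4 ^ n))"
      by (intro sum.cong HOL.refl) (simp add: weight_def)
    also have "\<dots> = ntrees n * (pointed_weight p / (ntrees n * 4 ^ n))"
      by (simp add: ntrees_eq)
    also have "\<dots> = pointed_weight p / 4 ^ n"
      using ntrees_pos[OF assms] by simp
    finally show "(\<Sum>b | leaves b = n. weight (p, b)) = pointed_weight p / 4 ^ n" .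
  qed
  finally show ?thesis by (simp add: sum_divide_distrib)
qed

abbreviation is_last :: "state \<Rightarrow> bool" where
  "is_last s \<equiv> snd (snd (fst s)) = []"

abbreviation at_leaf :: "state \<Rightarrow> bool" where
  "at_leaf s \<equiv> fst (snd (fst s)) = Leaf"

text \<open>Two different \<open>y\<close>-edges would leave the state obtained by splitting the marked caret of a
  cancelling state, so the one into the cancelling state is dropped.\<close>

inductive cancelling :: "state \<Rightarrow> bool" where
  "cancelling ((L, Node Leaf Leaf, R), split_leaf (forest_leaves L) b)"

lemma mass_total: "0 < n \<Longrightarrow> mass n (\<lambda>_. True) = 1 - last_mass n"
  using mass_fst[of n "\<lambda>_. True"] sum_pointed_weight[of n]
  by (simp add: last_mass_def diff_divide_distrib)

lemma mass_last: "0 < n \<Longrightarrow> mass n is_last = last_mass n"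
  using mass_fst[of n "\<lambda>p. snd (snd p) = []"] by (simp only: sum_pointed_weight_last last_mass_def)

lemma mass_leaf: "0 < n \<Longrightarrow> mass n at_leaf = 1 / 2"
  using sum_pointed_weight_tree[of "n - 1" Leaf]
  by (cases n) (simp_all add: mass_fst[of _ "\<lambda>p. fst (snd p) = Leaf"])

text \<open>A cancelling state is determined by its two side forests and the bottom tree before
  splitting; \<open>split_leaf_inject\<close> recovers the latter.\<close>

lemma mass_cancelling:
  "mass (Suc (Suc n)) cancelling = ntrees (Suc n) / (8 * ntrees (Suc (Suc n)))"
proof -
  let ?D = "{(L, R). forest_leaves L + forest_leaves R = n} \<times> {b. leaves b = Suc n}"
  let ?h = "\<lambda>((L, R), b). ((L, Node Leaf Leaf, R), split_leaf (forest_leaves L) b)"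
  have "{s. s \<in> level (Suc (Suc n)) \<and> cancelling s} = ?h ` ?D"
    by (auto simp: level_def image_iff cancelling.simps) blast
  moreover have "inj_on ?h ?D"
    by (auto simp: inj_on_def dest: split_leaf_inject)
  ultimately have "mass (Suc (Suc n)) cancelling = (\<Sum>s\<in>?D. weight (?h s))"
    by (simp add: mass_def sum.reindex)
  also have "\<dots> = (\<Sum>(q, b)\<in>?D. (case q of (L, R) \<Rightarrow> 2 ^ length L * 2 ^ length R) *
      (2 / (ntrees (Suc (Suc n)) * 4 ^ Suc (Suc n))))"
    by (intro sum.cong HOL.refl) (auto simp: weight_def)
  also have "\<dots> = (\<Sum>(L, R) | forest_leaves L + forest_leaves R = n. 2 ^ length L * 2 ^ length R) *
      (\<Sum>b | leaves b = Suc n. 2 / (ntrees (Suc (Suc n)) * 4 ^ Suc (Suc n)))"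
    by (simp only: sum.cartesian_product[symmetric] sum_product)
  also have "\<dots> = 4 ^ n * (ntrees (Suc n) * (2 / (ntrees (Suc (Suc n)) * 4 ^ Suc (Suc n))))"
    by (simp only: sum_two_forests ntrees_eq sum_constant)
  also have "\<dots> = ntrees (Suc n) / (8 * ntrees (Suc (Suc n)))"
    by simp
  finally show ?thesis .
qed

lemma mass_cancelling_le:
  assumes "100 \<le> n"
  shows "mass n cancelling \<le> 0.0318"
proof -
  define m where "m = n - 2"
  have n: "n = Suc (Suc m)" and m: "98 \<le> m"
    using assms by (simp_all add: m_def)
  have "real (m + 2) * ntrees (m + 2) = (4 * real m + 2) * ntrees (m + 1)"
    using ntrees_Suc[of "m + 1"] by (simp add: add.assoc)
  \<comment> \<open>The quotient (m + 2) / (4m + 2) decreases to 1/4 and is 100/394 < 0.2544 at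
    \<open>m = 98\<close>; 0.2544 / 8 = 0.0318.\<close>
  moreover have "real (m + 2) * ntrees (m + 1) \<le> 0.2544 * (4 * real m + 2) * ntrees (m + 1)"
    using m ntrees_pos[of "m + 1"] by (intro mult_right_mono) auto
  ultimately have "real (m + 2) * ntrees (m + 1) \<le> real (m + 2) * (0.2544 * ntrees (m + 2))"
    by (simp add: algebra_simps)
  then have "ntrees (m + 1) \<le> 0.2544 * ntrees (m + 2)"
    by simp
  then show ?thesis
    using ntrees_pos[of "m + 2"] unfolding n mass_cancelling by (simp add: field_simps)
qed

text \<open>Here 0.4682 = 1 - 1/2 - 0.0318: the total less the marked leaves and the cancelling
  states.\<close>

lemma mass_merge_ge:
  assumes "100 \<le> n"
  shows "0.4682 - last_mass n \<le> mass n (\<lambda>s. \<not> at_leaf s \<and> \<not> cancelling s)"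
proof -
  have "mass n (\<lambda>_. True) =
      mass n at_leaf + mass n cancelling + mass n (\<lambda>s. \<not> at_leaf s \<and> \<not> cancelling s)"
  proof -
    have "{s. s \<in> level n \<and> True} = ({s. s \<in> level n \<and> at_leaf s} \<union> {s. s \<in> level n \<and> cancelling s}) \<union>
        {s. s \<in> level n \<and> \<not> at_leaf s \<and> \<not> cancelling s}"
      by auto
    then show ?thesis
      unfolding mass_def
      by (simp only:) (subst sum.union_disjoint, auto simp: finite_level cancelling.simps intro!: sum.union_disjoint)
  qed
  then show ?thesis
    using mass_cancelling_le[OF assms] mass_leaf[of n] mass_total[of n] assms by simp
qed

section \<open>The finite window of levels and its edges\<close>

definition states :: "nat \<Rightarrow> nat \<Rightarrow> state set" where
  "states A K = (\<Union>n\<in>{A..K}. level n)"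

lemma finite_states: "finite (states A K)"
  by (simp add: states_def finite_level)

lemma mem_states: "(p, b) \<in> states A K \<longleftrightarrow> leaves b = pointed_leaves p \<and> A \<le> leaves b \<and> leaves b \<le> K"
  by (auto simp: states_def level_def)

lemma sum_weight_states: "(\<Sum>s | s \<in> states A K \<and> Q s. weight s) = (\<Sum>n=A..K. mass n Q)"
proof -
  have "{s. s \<in> states A K \<and> Q s} = (\<Union>n\<in>{A..K}. {s. s \<in> level n \<and> Q s})"
    by (auto simp: states_def)
  then show ?thesis
    unfolding mass_def
    by (simp only:) (rule sum.UNION_disjoint, auto simp: finite_level, auto simp: level_def)
qed

fun advance :: "state \<Rightarrow> state" where
  "advance ((L, t, r # R), b) = ((t # L, r, R), b)"
| "advance s = s"

text \<open>The source of the \<open>y\<close>-edge into a state: undoing a merge at a leaf adds a caret to the bottom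
  tree below that leaf.\<close>

fun pred_y :: "state \<Rightarrow> state" where
  "pred_y ((L, Node l r, R), b) = ((L, l, r # R), b)"
| "pred_y ((L, Leaf, R), b) = ((L, Leaf, Leaf # R), split_leaf (forest_leaves L) b)"

text \<open>Moves and merges stay on their level. A \<open>y\<close>-edge into a marked leaf starts
  one level higher, so its target must lie below the top level \<open>K\<close>.\<close>

fun edges :: "nat \<Rightarrow> nat \<Rightarrow> thompson_gen \<Rightarrow> (state \<times> state) set" where
  "edges A K X = (\<lambda>u. (u, advance u)) ` {u. u \<in> states A K \<and> \<not> is_last u}"
| "edges A K Y = (\<lambda>v. (pred_y v, v)) `
    ({v. v \<in> states A K \<and> \<not> at_leaf v \<and> \<not> cancelling v} \<union> {v. v \<in> states A (K - 1) \<and> at_leaf v})"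

lemma pred_y_inject:
  assumes "pred_y u = pred_y v" "\<not> cancelling u" "\<not> cancelling v"
  shows "u = v"
proof -
  obtain L t R b L' t' R' b' where uv: "u = ((L, t, R), b)" "v = ((L', t', R'), b')"
    by (metis surj_pair)
  show ?thesis
    using assms unfolding uv
    by (cases t; cases t') (auto simp: cancelling.simps dest: split_leaf_inject)
qed

lemma not_cancelling_leaf: "at_leaf v \<Longrightarrow> \<not> cancelling v"
  by (auto simp: cancelling.simps)

lemma UNIV_thompson_gen: "(UNIV :: thompson_gen set) = {X, Y}"
  using thompson_gen.exhaust by blast

lemma labelled_graph_edges:
  assumes "1 \<le> K"
  shows "labelled_graph (states A K) (edges A K)"
proof
  fix a and u v u' v' :: state
  show "finite (UNIV :: thompson_gen set)"
    by (simp add: UNIV_thompson_gen)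
  show "finite (states A K)"
    by (rule finite_states)
  have "advance u \<in> states A K" if "u \<in> states A K" for u
    using that by (cases u rule: advance.cases) (auto simp: mem_states)
  moreover have "pred_y v \<in> states A K" if "v \<in> states A K" "\<not> at_leaf v" for v
    using that by (cases v rule: pred_y.cases) (auto simp: mem_states)
  moreover have "v \<in> states A K \<and> pred_y v \<in> states A K" if "v \<in> states A (K - 1)" "at_leaf v" for v
    using that assms by (cases v rule: pred_y.cases) (auto simp: mem_states)
  ultimately show "edges A K a \<subseteq> states A K \<times> states A K"
    by (cases a) auto
  have advance_inject: "u = u'" if "advance u = advance u'" "\<not> is_last u" "\<not> is_last u'" for u u'
    using that by (cases u rule: advance.cases; cases u' rule: advance.cases) auto
  have pred_y: "u = pred_y v \<and> \<not> cancelling v" if "(u, v) \<in> edges A K Y" for u v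
    using that not_cancelling_leaf[of v] by auto
  show "v = v'" if "(u, v) \<in> edges A K a" "(u, v') \<in> edges A K a"
  proof (cases a)
    case X
    then show ?thesis using that by auto
  next
    case Y
    then show ?thesis using that pred_y pred_y_inject by metis
  qed
  show "u = u'" if "(u, v) \<in> edges A K a" "(u', v) \<in> edges A K a"
    using that advance_inject by (cases a) auto
qed

lemma weight_advance: "\<not> is_last u \<Longrightarrow> weight (advance u) = weight u"
  by (cases u rule: advance.cases) (auto simp: weight_def)

lemma weight_pred_y_node: "\<not> at_leaf v \<Longrightarrow> weight (pred_y v) = 2 * weight v"
  by (cases v rule: pred_y.cases) (auto simp: weight_def)

text \<open>The source has one more tree (factor 2) and one more leaf: a factor 1/4 from the power
  of 4, and at least 1/4 from the number of bottom trees.\<close>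

lemma weight_pred_y_leaf:
  assumes "at_leaf v"
  shows "weight v / 8 \<le> weight (pred_y v)"
proof -
  obtain L R b where v: "v = ((L, Leaf, R), b)"
    using assms by (cases v rule: pred_y.cases) auto
  have "ntrees (leaves b + 1) \<le> 4 * ntrees (leaves b)"
    by (rule ntrees_Suc_le) simp
  then have "1 / (4 * ntrees (leaves b)) \<le> 1 / ntrees (leaves b + 1)"
    by (intro divide_left_mono mult_pos_pos ntrees_pos) auto
  then have "pointed_weight (L, Leaf, R) / (2 * 4 ^ leaves b) * (1 / (4 * ntrees (leaves b)))
      \<le> pointed_weight (L, Leaf, R) / (2 * 4 ^ leaves b) * (1 / ntrees (leaves b + 1))"
    by (rule mult_left_mono) simp
  then show ?thesis
    by (simp add: v weight_def field_simps)
qed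

lemma sum_edges_X:
  "(\<Sum>(u, v)\<in>edges A K X. sqrt (weight u) * sqrt (weight v)) = (\<Sum>n=A..K. mass n (\<lambda>s. \<not> is_last s))"
proof -
  have "(\<Sum>(u, v)\<in>edges A K X. sqrt (weight u) * sqrt (weight v)) =
      (\<Sum>u | u \<in> states A K \<and> \<not> is_last u. sqrt (weight u) * sqrt (weight (advance u)))"
    by (simp add: sum.reindex inj_on_def)
  also have "\<dots> = (\<Sum>u | u \<in> states A K \<and> \<not> is_last u. weight u)"
    by (intro sum.cong HOL.refl) (simp add: weight_advance less_imp_le[OF weight_pos])
  finally show ?thesis by (simp add: sum_weight_states)
qed

text \<open>An edge with end weights 2w and w contributes sqrt 2 times w; one with end weights at
  least w / 8 and w contributes at least sqrt (1/8) times w.\<close>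

lemma sum_edges_Y:
  "sqrt 2 * (\<Sum>n=A..K. mass n (\<lambda>s. \<not> at_leaf s \<and> \<not> cancelling s)) + sqrt 2 / 4 * (\<Sum>n=A..K - 1. mass n at_leaf)
    \<le> (\<Sum>(u, v)\<in>edges A K Y. sqrt (weight u) * sqrt (weight v))"
proof -
  let ?N = "{v. v \<in> states A K \<and> \<not> at_leaf v \<and> \<not> cancelling v}"
  let ?L = "{v. v \<in> states A (K - 1) \<and> at_leaf v}"
  have node: "sqrt 2 * weight v = sqrt (weight (pred_y v)) * sqrt (weight v)" if "v \<in> ?N" for v
    using that by (simp add: weight_pred_y_node real_sqrt_mult less_imp_le[OF weight_pos])
  have leaf: "sqrt 2 / 4 * weight v \<le> sqrt (weight (pred_y v)) * sqrt (weight v)" if "v \<in> ?L" for v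
  proof -
    have "sqrt 2 / 4 * weight v = sqrt (weight v / 8) * sqrt (weight v)"
    proof -
      have "sqrt (1 / 8) = sqrt 2 / 4"
        by (rule real_sqrt_unique) (auto simp: power_divide)
      moreover have "sqrt (weight v / 8) = sqrt (1 / 8) * sqrt (weight v)"
        unfolding real_sqrt_mult[symmetric] by simp
      ultimately show ?thesis
        using less_imp_le[OF weight_pos, of v] by (simp only: mult.assoc real_sqrt_mult_self abs_of_nonneg)
    qed
    also have "\<dots> \<le> sqrt (weight (pred_y v)) * sqrt (weight v)"
      using that weight_pred_y_leaf less_imp_le[OF weight_pos, of v] by (intro mult_right_mono) auto
    finally show ?thesis .
  qed
  have "(\<Sum>(u, v)\<in>edges A K Y. sqrt (weight u) * sqrt (weight v)) =
      (\<Sum>v\<in>?N \<union> ?L. sqrt (weight (pred_y v)) * sqrt (weight v))"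
    by (simp add: sum.reindex inj_on_def)
  also have "\<dots> = (\<Sum>v\<in>?N. sqrt (weight (pred_y v)) * sqrt (weight v)) +
      (\<Sum>v\<in>?L. sqrt (weight (pred_y v)) * sqrt (weight v))"
    by (intro sum.union_disjoint) (auto simp: finite_states)
  also have "\<dots> \<ge> (\<Sum>v\<in>?N. sqrt 2 * weight v) + (\<Sum>v\<in>?L. sqrt 2 / 4 * weight v)"
    using node leaf by (intro add_mono sum_mono) auto
  finally show ?thesis
    by (simp only: sum_distrib_left[symmetric] sum_weight_states)
qed

text \<open>All boundary losses are bounded by multiples of \<open>G\<close>, of order sqrt
  \<open>K\<close>, and by one missing level, against about \<open>K\<close> levels. The start 100
  serves \<open>mass_cancelling_le\<close>.\<close>

lemma rayleigh_edges:
  defines "A \<equiv> 100" and "K \<equiv> 1000000"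
  shows "3.643 * (\<Sum>s\<in>states A K. (sqrt (weight s))\<^sup>2) \<le>
    2 * (\<Sum>a\<in>UNIV. \<Sum>(u, v)\<in>edges A K a. sqrt (weight u) * sqrt (weight v))"
    and "0 < (\<Sum>s\<in>states A K. (sqrt (weight s))\<^sup>2)"
proof -
  define G where "G = (\<Sum>n=A..K. last_mass n)"
  define M where "M = real (K + 1 - A)"
  have sum_const: "(\<Sum>n=A..K. c) = M * c" for c :: real
    by (simp add: M_def)
  have G_le: "G \<le> 1415"
  proof -
    have "G \<le> (\<Sum>n\<le>K. last_mass n)"
      unfolding G_def by (rule sum_mono2) (auto simp: last_mass_nonneg)
    \<comment> \<open>1415^2 = 2002225 exceeds 2 * 1000000 + 1.\<close>
    moreover have "(\<Sum>n\<le>K. last_mass n)\<^sup>2 \<le> 1415\<^sup>2"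
      using sum_last_mass_squared_le[of K] by (simp add: K_def)
    ultimately show ?thesis
      using power2_le_imp_le[of "\<Sum>n\<le>K. last_mass n" 1415] by linarith
  qed
  have G_nonneg: "0 \<le> G"
    by (simp add: G_def sum_nonneg last_mass_nonneg)
  have norm: "(\<Sum>s\<in>states A K. (sqrt (weight s))\<^sup>2) = M - G"
  proof -
    have "(\<Sum>s\<in>states A K. (sqrt (weight s))\<^sup>2) = (\<Sum>n=A..K. mass n (\<lambda>_. True))"
      using sum_weight_states[of A K "\<lambda>_. True"] by (simp add: less_imp_le[OF weight_pos])
    also have "\<dots> = (\<Sum>n=A..K. 1 - last_mass n)"
      by (intro sum.cong HOL.refl mass_total) (auto simp: A_def)
    finally show ?thesis by (simp add: sum_subtractf G_def M_def)
  qed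
  \<comment> \<open>\<open>last_mass n\<close> is lost twice: once in the total, once for the states
    that cannot advance.\<close>
  have "(\<Sum>n=A..K. mass n (\<lambda>s. \<not> is_last s)) = (\<Sum>n=A..K. 1 - 2 * last_mass n)"
  proof (intro sum.cong HOL.refl)
    fix n assume "n \<in> {A..K}"
    then have n: "0 < n" by (simp add: A_def)
    have "{s. s \<in> level n \<and> True} = {s. s \<in> level n \<and> is_last s} \<union> {s. s \<in> level n \<and> \<not> is_last s}"
      by auto
    then have "mass n (\<lambda>_. True) = mass n is_last + mass n (\<lambda>s. \<not> is_last s)"
      unfolding mass_def by (simp only:) (rule sum.union_disjoint, auto simp: finite_level)
    then show "mass n (\<lambda>s. \<not> is_last s) = 1 - 2 * last_mass n"
      using mass_total[OF n] mass_last[OF n] by simp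
  qed
  then have X: "(\<Sum>(u, v)\<in>edges A K X. sqrt (weight u) * sqrt (weight v)) = M - 2 * G"
    by (simp only: sum_edges_X sum_subtractf sum_const sum_distrib_left[symmetric] G_def mult_1_right)
  have "(\<Sum>n=A..K. 0.4682 - last_mass n) \<le> (\<Sum>n=A..K. mass n (\<lambda>s. \<not> at_leaf s \<and> \<not> cancelling s))"
    by (intro sum_mono mass_merge_ge) (simp add: A_def)
  then have merge: "M * 0.4682 - G \<le> (\<Sum>n=A..K. mass n (\<lambda>s. \<not> at_leaf s \<and> \<not> cancelling s))"
    by (simp only: sum_subtractf sum_const G_def)
  have "(\<Sum>n=A..K - 1. mass n at_leaf) = (\<Sum>n=A..K - 1. 1 / 2)"
    by (intro sum.cong HOL.refl mass_leaf) (auto simp: A_def)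
  then have leaf: "(\<Sum>n=A..K - 1. mass n at_leaf) = (M - 1) / 2"
    by (simp add: M_def K_def A_def)
  have M: "M = 999901"
    by (simp add: M_def A_def K_def)
  have sqrt2: "1.414 \<le> sqrt 2"
    by (rule real_le_rsqrt) (simp add: power2_eq_square)
  have Y: "1.414 * (M * 0.4682 - G) + 1.414 / 4 * ((M - 1) / 2) \<le>
      (\<Sum>(u, v)\<in>edges A K Y. sqrt (weight u) * sqrt (weight v))"
  proof -
    have "1.414 * (M * 0.4682 - G) \<le> sqrt 2 * (\<Sum>n=A..K. mass n (\<lambda>s. \<not> at_leaf s \<and> \<not> cancelling s))"
      using sqrt2 merge M G_le by (intro mult_mono) auto
    moreover have "1.414 / 4 * ((M - 1) / 2) \<le> sqrt 2 / 4 * (\<Sum>n=A..K - 1. mass n at_leaf)"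
      unfolding leaf using sqrt2 M by (intro mult_right_mono) auto
    ultimately show ?thesis using sum_edges_Y[of A K] by linarith
  qed
  define S where "S a = (\<Sum>(u, v)\<in>edges A K a. sqrt (weight u) * sqrt (weight v))" for a
  have "1677403000 - 2828 * G \<le> 2000 * S Y"
    using Y[folded S_def] by (simp add: M field_simps)
  moreover have "S X = 999901 - 2 * G"
    using X[folded S_def] by (simp add: M)
  \<comment> \<open>After collecting terms the claim is 3185 G \<le> 34565657, far from tight for G
    \<le> 1415.\<close>
  ultimately have "3643 * (999901 - G) \<le> 2000 * (S X + S Y)"
    using G_le by argo
  then have "3.643 * (M - G) \<le> 2 * (S X + S Y)"
    by (simp add: M)
  then show "3.643 * (\<Sum>s\<in>states A K. (sqrt (weight s))\<^sup>2) \<le>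
      2 * (\<Sum>a\<in>UNIV. \<Sum>(u, v)\<in>edges A K a. sqrt (weight u) * sqrt (weight v))"
    unfolding norm S_def[symmetric] by (simp add: UNIV_thompson_gen)
  show "0 < (\<Sum>s\<in>states A K. (sqrt (weight s))\<^sup>2)"
    using G_le M norm by simp
qed

section \<open>The lower bound\<close>

text \<open>\<open>state_val\<close> maps the graph to the Cayley graph of F for right
  multiplication and preserves labels, so closed walks spell the identity.\<close>

lemma state_val_edge:
  assumes "(u, v) \<in> edges A K a"
  shows "state_val v = state_val u + of_word [Gen a]"
proof (cases a)
  case X
  then have v: "v = advance u" and "\<not> is_last u"
    using assms by auto
  then obtain L t r R b where u: "u = ((L, t, r # R), b)"
    by (cases u rule: advance.cases) auto
  show ?thesis
    unfolding X v u advance.simps by (rule state_val_move)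
next
  case Y
  then have u: "u = pred_y v" and "v \<in> states A K \<or> v \<in> states A (K - 1)"
    using assms by auto
  then show ?thesis
  proof (cases v rule: pred_y.cases)
    case (1 L l r R b)
    show ?thesis
      unfolding Y u 1 pred_y.simps by (rule state_val_merge)
  next
    case (2 L R b)
    \<comment> \<open>The top and bottom have equally many leaves, and the marked leaf makes the
      inequality strict.\<close>
    have "forest_leaves L < leaves b"
      using \<open>v \<in> states A K \<or> v \<in> states A (K - 1)\<close> unfolding 2 mem_states by auto
    then show ?thesis
      unfolding Y u 2 pred_y.simps by (rule state_val_cancel)
  qed
qed

lemma state_val_walk: "walk (edges A K) w u v \<Longrightarrow> state_val v = state_val u + of_word w"
proof (induction w arbitrary: u)
  case Nil
  then show ?case by (simp add: of_word_Nil)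
next
  case (Cons l w)
  then obtain u' where step: "step (edges A K) l u u'" and "state_val v = state_val u' + of_word w"
    by auto
  moreover have "state_val u' = state_val u + of_word [l]"
    using step state_val_edge by (cases l) (auto simp: of_word_Inv eq_diff_eq)
  ultimately show ?case
    by (simp add: of_word_Cons[of l w] add.assoc)
qed

lemma card_walks_le_cogrowth:
  assumes "labelled_graph V (edges A K)"
  shows "card (walks (edges A K) (2 * n) u u) \<le> cogrowth n"
  unfolding cogrowth_def
proof (rule card_mono)
  have "finite {w :: thompson_gen letter list. length w = 2 * n}"
    using finite_lists_length_eq[OF labelled_graph.finite_letters[OF assms], of "2 * n"] by simp
  then show "finite {w. length w = 2 * n \<and> thompson_value w = \<one>\<^bsub>thompson_F\<^esub>}"
    by simp
  show "walks (edges A K) (2 * n) u u \<subseteq> {w. length w = 2 * n \<and> thompson_value w = \<one>\<^bsub>thompson_F\<^esub>}"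
  proof
    fix w assume "w \<in> walks (edges A K) (2 * n) u u"
    then have w: "length w = 2 * n" "walk (edges A K) w u u"
      by (simp_all add: walks_def)
    then have "state_val u + of_word w = state_val u + 0"
      using state_val_walk[OF w(2)] by (simp del: state_val.simps)
    then have "of_word w = 0"
      by (simp only: add_left_cancel)
    then show "w \<in> {w. length w = 2 * n \<and> thompson_value w = \<one>\<^bsub>thompson_F\<^esub>}"
      using w by (simp add: thompson_value_one_iff_of_word)
  qed
qed

text \<open>The constant is the number of states: the closed walks at each of them number at most
  \<open>cogrowth n\<close>.\<close>

lemma cogrowth_ge: "\<exists>C>0. \<forall>n. 3.643 ^ (2 * n) \<le> C * real (cogrowth n)"
proof -
  define A K :: nat where "A = 100" and "K = 1000000"
  define C where "C = real (card (states A K))"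
  interpret labelled_graph "states A K" "edges A K"
    by (rule labelled_graph_edges) (simp add: K_def)
  note ray = rayleigh_edges[folded A_def K_def]
  have "states A K \<noteq> {}"
    using ray(2) by auto
  then have "0 < C"
    by (simp add: C_def finite_states card_gt_0_iff)
  moreover have "3.643 ^ (2 * n) \<le> C * real (cogrowth n)" for n
  proof -
    have "3.643 ^ (2 * n) \<le> (\<Sum>u\<in>states A K. real (card (walks (edges A K) (2 * n) u u)))"
      by (rule sum_closed_walks_ge[OF _ ray(2) ray(1)]) simp
    also have "\<dots> \<le> (\<Sum>u\<in>states A K. real (cogrowth n))"
      by (intro sum_mono) (simp add: card_walks_le_cogrowth[OF labelled_graph_axioms])
    finally show ?thesis by (simp add: C_def)
  qed
  ultimately show ?thesis by blast
qed

text \<open>The n-th root of a positive constant tends to 1, so the factor \<open>C\<close> does not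
  affect the growth rate.\<close>

lemma limsup_root_ge:
  fixes q C :: real and c :: "nat \<Rightarrow> real"
  assumes "0 \<le> q" "0 < C" "\<And>n. q ^ n \<le> C * c n"
  shows "ereal q \<le> limsup (\<lambda>n. ereal (root n (c n)))"
proof -
  have "eventually (\<lambda>n. ereal (q / root n C) \<le> ereal (root n (c n))) sequentially"
    using eventually_gt_at_top[of 0]
  proof eventually_elim
    case (elim n)
    have "q = root n (q ^ n)"
      using elim assms(1) by (simp add: real_root_power_cancel)
    also have "\<dots> \<le> root n (C * c n)"
      using assms(3) elim by (intro real_root_le_mono)
    also have "\<dots> = root n C * root n (c n)"
      by (rule real_root_mult)
    finally show ?case
      using assms(2) elim by (simp add: divide_le_eq real_root_gt_zero mult.commute)
  qed
  then have "limsup (\<lambda>n. ereal (q / root n C)) \<le> limsup (\<lambda>n. ereal (root n (c n)))"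
    by (rule Limsup_mono)
  moreover have "(\<lambda>n. ereal (q / root n C)) \<longlonglongrightarrow> ereal (q / 1)"
    by (intro tendsto_ereal tendsto_divide tendsto_const LIMSEQ_root_const[OF assms(2)]) simp
  then have "limsup (\<lambda>n. ereal (q / root n C)) = ereal (q / 1)"
    by (rule lim_imp_Limsup[rotated]) simp
  ultimately show ?thesis by simp
qed

theorem mainTheorem6: "cogrowth_rate \<ge> ereal 13.2693"
proof -
  obtain C :: real where C: "0 < C" "\<And>n. 3.643 ^ (2 * n) \<le> C * real (cogrowth n)"
    using cogrowth_ge by blast
  \<comment> \<open>3.643^2 = 13.271449; the square appears because words of length 2n are counted
    but n-th roots are taken.\<close>
  have "ereal 13.2693 \<le> ereal (3.643\<^sup>2)"
    by (simp add: power2_eq_square)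
  also have "\<dots> \<le> cogrowth_rate"
    unfolding cogrowth_rate_def
    by (rule limsup_root_ge[OF _ C(1)]) (simp_all only: C(2) power_mult[symmetric] zero_le_power2)
  finally show ?thesis .
qed

end
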